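(* Let $K$ be a field, $P=K[x_1,\dots,x_n]$, $I\subset P$ a 0-dimensional ideal, $R=P/I$, let $\mathfrak m_1,\dots,\mathfrak m_s$ be the maximal ideals of $R$, and let $i\in\{1,\dots,s\}$. Let $L_i=R/\mathfrak m_i$, $\ell_i=\dim_K(L_i)$, let $S_i$ be the $i$-th socle space of $R$, let $k_i=\dim_{L_i}(S_i)$ and $m_i=\ell_ik_i$. Let $(e_1,\dots,e_{\ell_i})$ be a $K$-basis of $L_i$, let $(f_1,\dots,f_{m_i})$ be a $K$-basis of $S_i$, and let $M_i=(L(e_jf_k))_{j,k}$ be the $\ell_i\times m_i$ matrix with entries in the $K$-vector space $F_{\mathrm{ri}(R)}R/F_{\mathrm{ri}(R)-1}R$ given by $$L(e_jf_k)=\begin{cases}\mathrm{LF}_{\mathcal F}(e_jf_k)&\text{if }\mathrm{ord}_{\mathcal F}(e_jf_k)=\mathrm{ri}(R),\\0&\text{otherwise.}\end{cases}$$ Then $\mathrm{sepdeg}(\mathfrak m_i)=\mathrm{ri}(R)$ if and only if the columns of $M_i$ are $K$-linearly independent.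
   Context: Setting: $I$ is a proper ideal of $P=K[x_1,\dots,x_n]$ such that $\dim_K(P/I)<\infty$; $R=P/I$ is always considered with this fixed presentation. Degree filtration: $F_iP=\{f\in P\mid \deg f\le i\}\cup\{0\}$, $F_iI=F_iP\cap I$, and $F_iR=F_iP/F_iI$ is the image of $F_iP$ in $R$ ($i\in\mathbb Z$). $\mathrm{HF}^a_R(i)=\dim_K F_iR$. The regularity index is $\mathrm{ri}(R)=\min\{i\in\mathbb Z\mid \mathrm{HF}^a_R(j)=\dim_K R \text{ for all } j\ge i\}$. For $f\in R\setminus\{0\}$, $\mathrm{ord}_{\mathcal F}(f)=\min\{i\mid f\in F_iR\}$; if $\gamma=\mathrm{ord}_{\mathcal F}(f)$, the leading form is $\mathrm{LF}_{\mathcal F}(f)=f+F_{\gamma-1}R\in F_\gamma R/F_{\gamma-1}R$. Let $I=\mathfrak Q_1\cap\dots\cap\mathfrak Q_s$ be the primary decomposition, $\mathfrak M_i=\mathrm{Rad}(\mathfrak Q_i)$ (maximal ideals), and let $\mathfrak q_i,\mathfrak m_i$ be the images of $\mathfrak Q_i,\mathfrak M_i$ in $R$. The Chinese Remainder Theorem gives an isomorphism $\imath: R\to R/\mathfrak q_1\times\dots\times R/\mathfrak q_s$ with local factors. With $\mathrm{Soc}(R/\mathfrak q_i)$ the annihilator of the maximal ideal of $R/\mathfrak q_i$, the $i$-th socle space is $S_i=\imath^{-1}(\{0\}\times\dots\times\mathrm{Soc}(R/\mathfrak q_i)\times\dots\times\{0\})$. It is an ideal of $R$ annihilated by $\mathfrak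 m_i$, hence an $L_i$-vector space; the products $e_jf_k\in S_i$ use this structure. A $\mathfrak Q_i$-divisor of $I$ is an ideal $J=\mathfrak Q_1\cap\dots\cap\mathfrak Q_i'\cap\dots\cap\mathfrak Q_s$ ($\mathfrak Q_i$ replaced by $\mathfrak Q_i'$), where $\mathfrak Q_i'$ is an ideal of $P$ with $\mathfrak Q_i\subsetneq\mathfrak Q_i'$ (so $\mathfrak Q_i'\subseteq\mathfrak M_i$ or $\mathfrak Q_i'=P$). It is minimal if $\dim_K(J/I)=\ell_i$. For a minimal $\mathfrak Q_i$-divisor $J$ with image $\bar J=J/I$ in $R$, put $\mathrm{ri}(\bar J)=\max\{\mathrm{ord}_{\mathcal F}(f)\mid f\in\bar J\setminus\{0\}\}$. The separator degree is $\mathrm{sepdeg}(\mathfrak m_i)=\min\{\mathrm{ri}(\bar J)\mid J\text{ a minimal }\mathfrak Q_i\text{-divisor of }I\}$. *)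

theory Defs
  imports "HOL-Library.Poly_Mapping" "HOL-Algebra.QuotRing" "Jordan_Normal_Form.VS_Connect"
begin

section \<open>Generic notions\<close>

text \<open>The quotient of an algebra or vector space \<open>V\<close> by \<open>W\<close>: it is \<^term>\<open>V Quot W\<close> together with
  the induced scalar multiplication.  Its multiplication and unit are only meaningful if \<open>W\<close> is
  an ideal; otherwise only the module structure is used.\<close>

definition quot_module ::
    "('c, 'a, 'm) module_scheme \<Rightarrow> 'a set \<Rightarrow> ('c, 'a set) module" where
  "quot_module V W =
    \<lparr>carrier = a_rcosets\<^bsub>V\<^esub> W, mult = rcoset_mult V W, one = W +>\<^bsub>V\<^esub> \<one>\<^bsub>V\<^esub>,
     zero = W, add = set_add V,
     smult = (\<lambda>c X. \<Union>x\<in>X. W +>\<^bsub>V\<^esub> (c \<odot>\<^bsub>V\<^esub> x))\<rparr>"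

definition radical :: "('a, 'm) ring_scheme \<Rightarrow> 'a set \<Rightarrow> 'a set" where
  "radical A J = {a \<in> carrier A. \<exists>n::nat. a [^]\<^bsub>A\<^esub> n \<in> J}"

definition primary_ideal :: "'a set \<Rightarrow> ('a, 'm) ring_scheme \<Rightarrow> bool" where
  "primary_ideal J A \<longleftrightarrow>
    ideal J A \<and> J \<noteq> carrier A \<and>
    (\<forall>a\<in>carrier A. \<forall>b\<in>carrier A. a \<otimes>\<^bsub>A\<^esub> b \<in> J \<longrightarrow> a \<in> J \<or> b \<in> radical A J)"

text \<open>Components are indexed by \<open>1, \<dots>, s\<close>; as usual, a primary decomposition is taken to be
  irredundant with pairwise distinct radicals.\<close>

definition primary_decomposition ::
    "('a, 'm) ring_scheme \<Rightarrow> 'a set \<Rightarrow> nat \<Rightarrow> (nat \<Rightarrow> 'a set) \<Rightarrow> bool" where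
  "primary_decomposition A I s Q \<longleftrightarrow>
    (\<forall>j\<in>{1..s}. primary_ideal (Q j) A) \<and>
    I = carrier A \<inter> (\<Inter>j\<in>{1..s}. Q j) \<and>
    inj_on (\<lambda>j. radical A (Q j)) {1..s} \<and>
    (\<forall>j\<in>{1..s}. carrier A \<inter> (\<Inter>l\<in>{1..s} - {j}. Q l) \<noteq> I)"

text \<open>The socle of a local ring: the annihilator of its unique maximal ideal.\<close>

definition local_socle :: "('a, 'm) ring_scheme \<Rightarrow> 'a set" where
  "local_socle A =
    {x \<in> carrier A. \<forall>y \<in> (THE M. maximalideal M A). y \<otimes>\<^bsub>A\<^esub> x = \<zero>\<^bsub>A\<^esub>}"

definition basis_tuple ::
    "('c, 'r) ring_scheme \<Rightarrow> ('c, 'a, 'm) module_scheme \<Rightarrow> nat \<Rightarrow> (nat \<Rightarrow> 'a) \<Rightarrow> bool" where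
  "basis_tuple K V N b \<longleftrightarrow> inj_on b {1..N} \<and> vectorspace.basis K V (b ` {1..N})"

text \<open>Linear independence, as a family (repeated columns are dependent), of the columns of an
  \<open>l \<times> m\<close> matrix with entries in \<open>V\<close>.\<close>

definition columns_lin_indpt ::
    "('c, 'r) ring_scheme \<Rightarrow> ('c, 'a, 'm) module_scheme \<Rightarrow> nat \<Rightarrow> nat \<Rightarrow> (nat \<Rightarrow> nat \<Rightarrow> 'a) \<Rightarrow> bool"
  where
  "columns_lin_indpt K V l m M \<longleftrightarrow>
    (\<forall>c \<in> {1..m} \<rightarrow> carrier K.
      (\<forall>j\<in>{1..l}. (\<Oplus>\<^bsub>V\<^esub>k\<in>{1..m}. c k \<odot>\<^bsub>V\<^esub> M j k) = \<zero>\<^bsub>V\<^esub>) \<longrightarrow>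
      (\<forall>k\<in>{1..m}. c k = \<zero>\<^bsub>K\<^esub>))"


section \<open>The polynomial ring and its degree filtration\<close>

text \<open>Polynomials over the field \<open>'k\<close> in finitely many indeterminates, indexed by the type \<open>'n\<close>.  The
  field itself, as a record, is \<^term>\<open>class_ring :: 'k::field ring\<close>.\<close>

type_synonym ('n, 'k) mpoly = "('n \<Rightarrow>\<^sub>0 nat) \<Rightarrow>\<^sub>0 'k"

definition poly_alg :: "('k::field, ('n::finite, 'k) mpoly) module" where
  "poly_alg = \<lparr>carrier = UNIV, mult = (*), one = 1, zero = 0, add = (+),
               smult = (\<lambda>c f. Poly_Mapping.single 0 c * f)\<rparr>"

text \<open>The total degree of a nonzero polynomial.\<close>

definition total_deg :: "('n::finite, 'k::field) mpoly \<Rightarrow> nat" where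
  "total_deg f = Max ((\<lambda>t. \<Sum>v\<in>UNIV. Poly_Mapping.lookup t v) ` Poly_Mapping.keys f)"

definition poly_filt :: "int \<Rightarrow> ('n::finite, 'k::field) mpoly set" where
  "poly_filt i = {f. f \<noteq> 0 \<and> int (total_deg f) \<le> i} \<union> {0}"


section \<open>The affine algebra \<open>R = P/I\<close>\<close>

definition aff_alg :: "('n::finite, 'k::field) mpoly set \<Rightarrow> ('k, ('n, 'k) mpoly set) module" where
  "aff_alg I = quot_module poly_alg I"

text \<open>The image in \<open>P/I\<close> of a set of polynomials.\<close>

definition img :: "('n::finite, 'k::field) mpoly set \<Rightarrow> ('n, 'k) mpoly set \<Rightarrow> ('n, 'k) mpoly set set"
  where "img I A = (\<lambda>f. I +>\<^bsub>poly_alg\<^esub> f) ` A"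

definition deg_filt :: "('n::finite, 'k::field) mpoly set \<Rightarrow> int \<Rightarrow> ('n, 'k) mpoly set set" where
  "deg_filt I i = img I (poly_filt i)"

definition aff_HF :: "('n::finite, 'k::field) mpoly set \<Rightarrow> int \<Rightarrow> nat" where
  "aff_HF I i = vectorspace.dim class_ring ((aff_alg I)\<lparr>carrier := deg_filt I i\<rparr>)"

definition reg_index :: "('n::finite, 'k::field) mpoly set \<Rightarrow> int" where
  "reg_index I = (LEAST i. \<forall>j\<ge>i. aff_HF I j = vectorspace.dim class_ring (aff_alg I))"

text \<open>The order and the leading form are only meaningful for nonzero residue classes.\<close>

definition filt_ord :: "('n::finite, 'k::field) mpoly set \<Rightarrow> ('n, 'k) mpoly set \<Rightarrow> int" where
  "filt_ord I x = (LEAST i. x \<in> deg_filt I i)"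

definition gr_part ::
    "('n::finite, 'k::field) mpoly set \<Rightarrow> int \<Rightarrow> ('k, ('n, 'k) mpoly set set) module" where
  "gr_part I i = quot_module ((aff_alg I)\<lparr>carrier := deg_filt I i\<rparr>) (deg_filt I (i - 1))"

definition lead_form ::
    "('n::finite, 'k::field) mpoly set \<Rightarrow> ('n, 'k) mpoly set \<Rightarrow> ('n, 'k) mpoly set set" where
  "lead_form I x = deg_filt I (filt_ord I x - 1) +>\<^bsub>aff_alg I\<^esub> x"

definition top_form ::
    "('n::finite, 'k::field) mpoly set \<Rightarrow> ('n, 'k) mpoly set \<Rightarrow> ('n, 'k) mpoly set set" where
  "top_form I x =
    (if x \<noteq> \<zero>\<^bsub>aff_alg I\<^esub> \<and> filt_ord I x = reg_index I then lead_form I x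
     else \<zero>\<^bsub>gr_part I (reg_index I)\<^esub>)"


section \<open>Maximal ideals, residue fields and socle spaces\<close>

text \<open>In the following, \<open>Q 1, \<dots>, Q s\<close> are the primary components of \<open>I\<close> in \<open>P\<close>.\<close>

definition max_id :: "('n::finite, 'k::field) mpoly set \<Rightarrow> (nat \<Rightarrow> ('n, 'k) mpoly set) \<Rightarrow> nat
    \<Rightarrow> ('n, 'k) mpoly set set" where
  "max_id I Q i = img I (radical poly_alg (Q i))"

text \<open>\<open>L\<^sub>i = R/\<mm>\<^sub>i\<close>, both as a ring and as a \<open>K\<close>-vector space.\<close>

definition res_field :: "('n::finite, 'k::field) mpoly set \<Rightarrow> (nat \<Rightarrow> ('n, 'k) mpoly set) \<Rightarrow> nat
    \<Rightarrow> ('k, ('n, 'k) mpoly set set) module" where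
  "res_field I Q i = quot_module (aff_alg I) (max_id I Q i)"

definition res_deg ::
    "('n::finite, 'k::field) mpoly set \<Rightarrow> (nat \<Rightarrow> ('n, 'k) mpoly set) \<Rightarrow> nat \<Rightarrow> nat" where
  "res_deg I Q i = vectorspace.dim class_ring (res_field I Q i)"

text \<open>The local factor \<open>R/\<qq>\<^sub>i\<close>.\<close>

definition loc_factor :: "('n::finite, 'k::field) mpoly set \<Rightarrow> (nat \<Rightarrow> ('n, 'k) mpoly set) \<Rightarrow> nat
    \<Rightarrow> ('k, ('n, 'k) mpoly set set) module" where
  "loc_factor I Q i = quot_module (aff_alg I) (img I (Q i))"

text \<open>The map of the Chinese Remainder Theorem from \<open>R\<close> to the product of the local factors.\<close>

definition crt_map :: "('n::finite, 'k::field) mpoly set \<Rightarrow> nat \<Rightarrow> (nat \<Rightarrow> ('n, 'k) mpoly set)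
    \<Rightarrow> ('n, 'k) mpoly set \<Rightarrow> nat \<Rightarrow> ('n, 'k) mpoly set set" where
  "crt_map I s Q r = (\<lambda>j\<in>{1..s}. img I (Q j) +>\<^bsub>aff_alg I\<^esub> r)"

definition socle_space :: "('n::finite, 'k::field) mpoly set \<Rightarrow> nat \<Rightarrow> (nat \<Rightarrow> ('n, 'k) mpoly set)
    \<Rightarrow> nat \<Rightarrow> ('n, 'k) mpoly set set" where
  "socle_space I s Q i =
    {r \<in> carrier (aff_alg I).
      crt_map I s Q r \<in> (\<Pi>\<^sub>E j\<in>{1..s}.
        if j = i then local_socle (loc_factor I Q i) else {\<zero>\<^bsub>loc_factor I Q j\<^esub>})}"

text \<open>\<open>S\<^sub>i\<close> as a vector space over \<open>K\<close>, and over \<open>L\<^sub>i\<close>: a residue class \<open>e \<in> L\<^sub>i\<close> acts as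
  multiplication by any of its representatives in \<open>R\<close>.\<close>

definition socle_K :: "('n::finite, 'k::field) mpoly set \<Rightarrow> nat \<Rightarrow> (nat \<Rightarrow> ('n, 'k) mpoly set)
    \<Rightarrow> nat \<Rightarrow> ('k, ('n, 'k) mpoly set) module" where
  "socle_K I s Q i = (aff_alg I)\<lparr>carrier := socle_space I s Q i\<rparr>"

definition socle_L :: "('n::finite, 'k::field) mpoly set \<Rightarrow> nat \<Rightarrow> (nat \<Rightarrow> ('n, 'k) mpoly set)
    \<Rightarrow> nat \<Rightarrow> (('n, 'k) mpoly set set, ('n, 'k) mpoly set) module" where
  "socle_L I s Q i =
    \<lparr>carrier = socle_space I s Q i,
     mult = mult (aff_alg I), one = one (aff_alg I), zero = zero (aff_alg I),
     add = add (aff_alg I),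
     smult = (\<lambda>e x. THE y. \<forall>a\<in>e. a \<otimes>\<^bsub>aff_alg I\<^esub> x = y)\<rparr>"


section \<open>Minimal divisors and the separator degree\<close>

definition is_divisor :: "('n::finite, 'k::field) mpoly set \<Rightarrow> nat \<Rightarrow> (nat \<Rightarrow> ('n, 'k) mpoly set)
    \<Rightarrow> nat \<Rightarrow> ('n, 'k) mpoly set \<Rightarrow> bool" where
  "is_divisor I s Q i J \<longleftrightarrow>
    (\<exists>Q'. ideal Q' (poly_alg :: ('k, ('n, 'k) mpoly) module) \<and> Q i \<subset> Q' \<and>
       J = (\<Inter>j\<in>{1..s}. (Q(i := Q')) j))"

definition is_min_divisor :: "('n::finite, 'k::field) mpoly set \<Rightarrow> nat \<Rightarrow> (nat \<Rightarrow> ('n, 'k) mpoly set)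
    \<Rightarrow> nat \<Rightarrow> ('n, 'k) mpoly set \<Rightarrow> bool" where
  "is_min_divisor I s Q i J \<longleftrightarrow>
    is_divisor I s Q i J \<and>
    vectorspace.dim class_ring ((aff_alg I)\<lparr>carrier := img I J\<rparr>) = res_deg I Q i"

definition ri_ideal :: "('n::finite, 'k::field) mpoly set \<Rightarrow> ('n, 'k) mpoly set set \<Rightarrow> int" where
  "ri_ideal I Jb = Max (filt_ord I ` (Jb - {\<zero>\<^bsub>aff_alg I\<^esub>}))"

definition sepdeg :: "('n::finite, 'k::field) mpoly set \<Rightarrow> nat \<Rightarrow> (nat \<Rightarrow> ('n, 'k) mpoly set)
    \<Rightarrow> nat \<Rightarrow> int" where
  "sepdeg I s Q i = (LEAST d. \<exists>J. is_min_divisor I s Q i J \<and> d = ri_ideal I (img I J))"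

end

theory Submission
  imports Defs
begin

text \<open>The images \<open>J/I\<close> of the minimal \<open>\<QQ>\<^sub>i\<close>-divisors are exactly the principal ideals
  \<open>Rg\<close> with \<open>0 \<noteq> g \<in> S\<^sub>i\<close>: such an ideal is isomorphic to \<open>L\<^sub>i\<close>, and conversely \<open>J/I\<close> contains a
  nonzero socle element \<open>g\<close>, so that \<open>Rg = J/I\<close> because both have dimension \<open>\<ell>\<^sub>i\<close>.  Since all orders
  are at most \<open>ri(R)\<close>, the separator degree is \<open>ri(R)\<close> if and only if no \<open>Rg\<close> is contained in
  \<open>F\<^bsub>ri(R)-1\<^esub>R\<close>.  As \<open>Rg\<close> is spanned by the \<open>e\<^sub>jg\<close>, and \<open>L\<close> is the residue map modulo
  \<open>F\<^bsub>ri(R)-1\<^esub>R\<close>, a nonzero \<open>g = \<Sum>c\<^sub>kf\<^sub>k\<close> with \<open>Rg \<subseteq> F\<^bsub>ri(R)-1\<^esub>R\<close> is the same as a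
  nontrivial linear relation between the columns.\<close>

section \<open>Quotients and subspaces of modules\<close>

text \<open>Finite dimension over K supplies all chain conditions: a member of least dimension in a
  family of ideals is minimal under inclusion, and an inclusion between ideals of equal dimension is
  an equality. This makes primes of R maximal. It also produces the socle element of J/I: in a
  minimal nonzero principal subideal Rg, a product yg that is nonzero with y in m_i would generate
  Rg again, so g would be divisible by all powers of y. That is impossible because J/I lies in the
  image of the intersection of the other primary components, and this image is annihilated by q_i,
  hence by a power of y. The obstacle is that the filtration step of index ri(R)-1 is a K-subspace,
  in general not an ideal. A column relation therefore has to control g together with all its
  R-multiples. The rows do this: m_i kills g, so a K-basis of L_i gives K-generators of Rg. Leading
  forms are not additive, but L is: the step of index ri(R) is all of R, and the elements of smaller
  order, together with 0, form exactly the zero class.\<close>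

text \<open>Additive inverses are not among the closure conditions of \<open>submodule\<close>; they
  come from the scalar -1. The result opens the library of additive cosets to arbitrary
  subspaces.\<close>

lemma (in Module.module) submodule_abelian_subgroup:
  assumes "submodule R W M" shows "abelian_subgroup W M"
proof -
  interpret W: submodule R W M by fact
  have inv: "\<ominus>\<^bsub>M\<^esub> x \<in> W" if "x \<in> W" for x
  proof -
    have "(\<ominus>\<^bsub>R\<^esub> \<one>\<^bsub>R\<^esub>) \<odot>\<^bsub>M\<^esub> x = \<ominus>\<^bsub>M\<^esub> x"
      using that W.subset smult_l_minus[of "\<one>\<^bsub>R\<^esub>" x] by auto
    moreover have "(\<ominus>\<^bsub>R\<^esub> \<one>\<^bsub>R\<^esub>) \<odot>\<^bsub>M\<^esub> x \<in> W"
      using that by (intro W.smult_closed) auto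
    ultimately show ?thesis by simp
  qed
  have "subgroup W (add_monoid M)"
  proof (rule M.add.subgroupI)
    show "W \<noteq> {}" using W.zero_closed by blast
  qed (use W.subset inv in \<open>auto simp: a_inv_def\<close>)
  then show ?thesis
    by (intro abelian_subgroupI3 additive_subgroup.intro M.abelian_group_axioms)
qed

lemma quot_module_sel [simp]:
  "carrier (quot_module V W) = (\<lambda>x. W +>\<^bsub>V\<^esub> x) ` carrier V"
  "\<zero>\<^bsub>quot_module V W\<^esub> = W"
  by (auto simp: quot_module_def A_RCOSETS_defs a_r_coset_def)

lemma quot_module_one: "\<one>\<^bsub>quot_module V W\<^esub> = W +>\<^bsub>V\<^esub> \<one>\<^bsub>V\<^esub>"
  by (simp add: quot_module_def)

lemma (in Module.module) quot_module_add:
  assumes "submodule R W M" "x \<in> carrier M" "y \<in> carrier M"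
  shows "(W +>\<^bsub>M\<^esub> x) \<oplus>\<^bsub>quot_module M W\<^esub> (W +>\<^bsub>M\<^esub> y) = W +>\<^bsub>M\<^esub> (x \<oplus>\<^bsub>M\<^esub> y)"
  using abelian_subgroup.a_rcos_sum[OF submodule_abelian_subgroup[OF assms(1)] assms(2,3)]
  by (simp add: quot_module_def)

lemma (in Module.module) coset_eq_iff:
  assumes "submodule R W M" "x \<in> carrier M" "y \<in> carrier M"
  shows "W +>\<^bsub>M\<^esub> x = W +>\<^bsub>M\<^esub> y \<longleftrightarrow> x \<ominus>\<^bsub>M\<^esub> y \<in> W"
proof -
  interpret W: abelian_subgroup W M using submodule_abelian_subgroup[OF assms(1)] .
  have "W +>\<^bsub>M\<^esub> x = W +>\<^bsub>M\<^esub> y \<longleftrightarrow> x \<in> W +>\<^bsub>M\<^esub> y"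
    using W.a_repr_independence'[OF _ assms(3), of x] W.a_rcos_self[OF assms(2)] by auto
  also have "\<dots> \<longleftrightarrow> x \<ominus>\<^bsub>M\<^esub> y \<in> W"
    using W.a_rcos_module[OF assms(3,2)] by (simp add: a_minus_def)
  finally show ?thesis .
qed

lemma (in Module.module) coset_eq_self_iff:
  assumes "submodule R W M" "x \<in> carrier M"
  shows "W +>\<^bsub>M\<^esub> x = W \<longleftrightarrow> x \<in> W"
proof -
  interpret W: abelian_subgroup W M using submodule_abelian_subgroup[OF assms(1)] .
  have "W +>\<^bsub>M\<^esub> \<zero>\<^bsub>M\<^esub> = W" using W.a_subset by simp
  then show ?thesis using coset_eq_iff[OF assms, of "\<zero>\<^bsub>M\<^esub>"] assms(2) by (simp add: a_minus_def M.add.inv_one[unfolded a_inv_def[symmetric]])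
qed

text \<open>The scalar action on a coset is defined as a union over all of its elements. All members
  of that union coincide, since two representatives differ by some \<open>w \<in> W\<close> and c
  times w stays in \<open>W\<close>.\<close>

lemma (in Module.module) quot_module_smult:
  assumes "submodule R W M" "c \<in> carrier R" "x \<in> carrier M"
  shows "c \<odot>\<^bsub>quot_module M W\<^esub> (W +>\<^bsub>M\<^esub> x) = W +>\<^bsub>M\<^esub> (c \<odot>\<^bsub>M\<^esub> x)"
proof -
  interpret W: submodule R W M by fact
  interpret WA: abelian_subgroup W M using submodule_abelian_subgroup[OF assms(1)] .
  have *: "W +>\<^bsub>M\<^esub> (c \<odot>\<^bsub>M\<^esub> y) = W +>\<^bsub>M\<^esub> (c \<odot>\<^bsub>M\<^esub> x)" if y: "y \<in> W +>\<^bsub>M\<^esub> x" for y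
  proof -
    obtain w where w: "w \<in> W" "y = w \<oplus>\<^bsub>M\<^esub> x"
      using y by (auto simp: a_r_coset_def')
    have wM: "w \<in> carrier M" using w(1) W.subset by auto
    have "c \<odot>\<^bsub>M\<^esub> y \<ominus>\<^bsub>M\<^esub> c \<odot>\<^bsub>M\<^esub> x = c \<odot>\<^bsub>M\<^esub> w"
      using w wM assms by (simp add: smult_r_distr a_minus_def M.a_assoc M.r_neg)
    then show ?thesis
      using coset_eq_iff[OF assms(1), of "c \<odot>\<^bsub>M\<^esub> y" "c \<odot>\<^bsub>M\<^esub> x"] w wM assms by simp
  qed
  have "x \<in> W +>\<^bsub>M\<^esub> x" using WA.a_rcos_self[OF assms(3)] .
  then have "(\<Union>y\<in>W +>\<^bsub>M\<^esub> x. W +>\<^bsub>M\<^esub> (c \<odot>\<^bsub>M\<^esub> y)) = W +>\<^bsub>M\<^esub> (c \<odot>\<^bsub>M\<^esub> x)"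
    by (intro SUP_eq_const *) auto
  then show ?thesis by (simp add: quot_module_def)
qed

lemma (in Module.module) quot_module_module:
  assumes W: "submodule R W M"
  shows "Module.module R (quot_module M W)"
proof -
  note add = quot_module_add[OF W] and smult = quot_module_smult[OF W]
  interpret W: submodule R W M by fact
  have W0: "W +>\<^bsub>M\<^esub> \<zero>\<^bsub>M\<^esub> = W" using W.subset by simp
  have W_add: "W \<oplus>\<^bsub>quot_module M W\<^esub> (W +>\<^bsub>M\<^esub> x) = W +>\<^bsub>M\<^esub> x" if "x \<in> carrier M" for x
    using add[of "\<zero>\<^bsub>M\<^esub>" x] that unfolding W0 by simp
  show ?thesis
  proof (rule moduleI)
    show "abelian_group (quot_module M W)"
    proof (rule abelian_groupI)
      fix X assume "X \<in> carrier (quot_module M W)"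
      then obtain x where x: "x \<in> carrier M" "X = W +>\<^bsub>M\<^esub> x" by auto
      have "(W +>\<^bsub>M\<^esub> (\<ominus>\<^bsub>M\<^esub> x)) \<oplus>\<^bsub>quot_module M W\<^esub> X = \<zero>\<^bsub>quot_module M W\<^esub>"
        using x(1) by (simp add: x(2) add M.l_neg W0)
      then show "\<exists>Y\<in>carrier (quot_module M W). Y \<oplus>\<^bsub>quot_module M W\<^esub> X = \<zero>\<^bsub>quot_module M W\<^esub>"
        using x(1) by (intro bexI) auto
    next
      show "\<zero>\<^bsub>quot_module M W\<^esub> \<in> carrier (quot_module M W)"
        using W0 by (auto intro: image_eqI[of _ _ "\<zero>\<^bsub>M\<^esub>"])
    qed (auto simp: add M.a_assoc W_add M.a_comm M.a_lcomm)
  qed (auto simp: add smult R.is_cring smult_l_distr smult_r_distr smult_assoc1)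
qed

lemma (in Module.module) quot_module_hom:
  assumes "submodule R W M"
  shows "mod_hom R M (quot_module M W) (\<lambda>x. W +>\<^bsub>M\<^esub> x)"
  using quot_module_module[OF assms] quot_module_add[OF assms] quot_module_smult[OF assms]
  by (auto simp: mod_hom_def mod_hom_axioms_def LinearCombinations.module_hom_def module_axioms)

section \<open>Finite sums, dimensions of subspaces, and coordinates\<close>

lemma (in mod_hom) hom_finsum:
  assumes "finite A" "g \<in> A \<rightarrow> carrier M"
  shows "f (\<Oplus>\<^bsub>M\<^esub>k\<in>A. g k) = (\<Oplus>\<^bsub>N\<^esub>k\<in>A. f (g k))"
  using assms
proof (induction A rule: finite_induct)
  case empty
  then show ?case by simp
next
  case (insert a A)
  have "f \<in> carrier M \<rightarrow> carrier N" using f_hom by (rule module_hom_closed)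
  with insert show ?case
    by (simp add: M.M.finsum_insert N.M.finsum_insert Pi_iff M.M.finsum_closed)
qed

text \<open>\<open>finsum\<close> depends on the carrier of its record, so a sum in a subspace and
  the same sum in the whole module are different terms. The inclusion is a module homomorphism and
  identifies them.\<close>

lemma (in Module.module) finsum_submodule:
  assumes "submodule R W M" "finite A" "g \<in> A \<rightarrow> W"
  shows "(\<Oplus>\<^bsub>M\<lparr>carrier := W\<rparr>\<^esub>k\<in>A. g k) = (\<Oplus>\<^bsub>M\<^esub>k\<in>A. g k)"
proof -
  interpret W: submodule R W M by fact
  interpret WM: Module.module R "M\<lparr>carrier := W\<rparr>" using submodule_is_module[OF assms(1)] .
  have "mod_hom R (M\<lparr>carrier := W\<rparr>) M (\<lambda>x. x)"
    using W.subset by (auto simp: mod_hom_def mod_hom_axioms_def LinearCombinations.module_hom_def module_axioms WM.module_axioms)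
  from mod_hom.hom_finsum[OF this assms(2)] assms(3) show ?thesis by simp
qed

text \<open>Independence of a subset of \<open>W\<close> does not depend on the ambient space, so
  \<open>dim\<close> bounds the size of independent subsets of \<open>W\<close>, and a maximal one
  is a basis of \<open>W\<close>. If it has \<open>dim\<close> elements, it is already a basis of
  \<open>V\<close>.\<close>

lemma (in vectorspace) submodule_dim:
  assumes fd: "fin_dim" and W: "submodule K W V"
  shows "vectorspace.fin_dim K (V\<lparr>carrier := W\<rparr>)"
    and "vectorspace.dim K (V\<lparr>carrier := W\<rparr>) \<le> dim"
    and "vectorspace.dim K (V\<lparr>carrier := W\<rparr>) = dim \<Longrightarrow> W = carrier V"
proof -
  interpret W: submodule K W V by fact
  interpret S: vectorspace K "V\<lparr>carrier := W\<rparr>"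
    using submodule_is_module[OF W] by (simp add: vectorspace_def field_axioms)
  note trans = span_li_not_depend[OF _ W]
  have bound: "finite B \<and> card B \<le> dim" if "B \<subseteq> W \<and> S.lin_indpt B" for B
    using li_le_dim[OF fd, of B] that trans[of B] W.subset by auto
  have "{} \<subseteq> W \<and> S.lin_indpt {}" by (auto simp: S.lin_dep_def)
  then obtain B where B: "finite B" "maximal B (\<lambda>B. B \<subseteq> W \<and> S.lin_indpt B)"
    using maximal_exists[of "\<lambda>B. B \<subseteq> W \<and> S.lin_indpt B" dim "{}"] bound by metis
  then have BW: "B \<subseteq> W" "S.lin_indpt B" by (auto simp: maximal_def)
  have gen: "S.gen_set B" using S.max_li_is_gen[of B] B by simp
  then show "S.fin_dim" using B(1) BW by (auto simp: S.fin_dim_def)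
  have dim: "S.dim = card B" using S.dim_basis[of B] B(1) BW gen by (simp add: S.basis_def)
  then show "S.dim \<le> dim" using bound BW by simp
  assume "S.dim = dim"
  then have "basis B"
    using dim_li_is_basis[OF fd B(1)] BW dim trans[of B] W.subset by auto
  then show "W = carrier V"
    using gen trans[of B] BW by (simp add: basis_def)
qed

lemma basis_tuple_expand:
  assumes "vectorspace K V" "basis_tuple K V N b"
  shows "b \<in> {1..N} \<rightarrow> carrier V"
    and "v \<in> carrier V \<Longrightarrow> \<exists>c \<in> {1..N} \<rightarrow> carrier K. v = (\<Oplus>\<^bsub>V\<^esub>k\<in>{1..N}. c k \<odot>\<^bsub>V\<^esub> b k)"
    and "c \<in> {1..N} \<rightarrow> carrier K \<Longrightarrow> (\<Oplus>\<^bsub>V\<^esub>k\<in>{1..N}. c k \<odot>\<^bsub>V\<^esub> b k) = \<zero>\<^bsub>V\<^esub> \<Longrightarrow> k \<in> {1..N}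
      \<Longrightarrow> c k = \<zero>\<^bsub>K\<^esub>"
proof -
  interpret vectorspace K V by fact
  have inj: "inj_on b {1..N}" and bas: "basis (b ` {1..N})"
    using assms(2) by (auto simp: basis_tuple_def)
  from bas show b: "b \<in> {1..N} \<rightarrow> carrier V" by (auto simp: basis_def)
  have lc: "lincomb a (b ` {1..N}) = (\<Oplus>\<^bsub>V\<^esub>k\<in>{1..N}. a (b k) \<odot>\<^bsub>V\<^esub> b k)"
    if "a \<in> b ` {1..N} \<rightarrow> carrier K" for a
    unfolding lincomb_def using that b inj
    by (intro finsum_reindex) auto
  show "\<exists>c \<in> {1..N} \<rightarrow> carrier K. v = (\<Oplus>\<^bsub>V\<^esub>k\<in>{1..N}. c k \<odot>\<^bsub>V\<^esub> b k)" if "v \<in> carrier V"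
  proof -
    have "v \<in> span (b ` {1..N})" using bas that by (simp add: basis_def)
    then obtain a where "a \<in> b ` {1..N} \<rightarrow> carrier K" "lincomb a (b ` {1..N}) = v"
      using finite_in_span[of "b ` {1..N}" v] b by auto
    then show ?thesis using lc by (intro bexI[of _ "a \<circ> b"]) auto
  qed
  show "c k = \<zero>\<^bsub>K\<^esub>" if c: "c \<in> {1..N} \<rightarrow> carrier K" and z: "(\<Oplus>\<^bsub>V\<^esub>k\<in>{1..N}. c k \<odot>\<^bsub>V\<^esub> b k) = \<zero>\<^bsub>V\<^esub>"
    and k: "k \<in> {1..N}"
  proof -
    \<comment> \<open>Linear combinations in the library take coefficients indexed by vectors;
      injectivity of \<open>b\<close> lets coefficients indexed by positions be transported.\<close>
    let ?a = "c \<circ> the_inv_into {1..N} b"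
    have inv: "?a (b j) = c j" if "j \<in> {1..N}" for j
      using that inj by (simp add: the_inv_into_f_f)
    have a: "?a \<in> b ` {1..N} \<rightarrow> carrier K" using c inv by auto
    have "lincomb ?a (b ` {1..N}) = (\<Oplus>\<^bsub>V\<^esub>k\<in>{1..N}. c k \<odot>\<^bsub>V\<^esub> b k)"
      unfolding lc[OF a] using inv c b by (intro M.finsum_cong') auto
    then have "lincomb ?a (b ` {1..N}) = \<zero>\<^bsub>V\<^esub>" using z by simp
    then have "?a \<in> b ` {1..N} \<rightarrow> {\<zero>\<^bsub>K\<^esub>}"
      using not_lindepD[of "b ` {1..N}" "b ` {1..N}" ?a] a bas by (auto simp: basis_def)
    then have "?a (b k) = \<zero>\<^bsub>K\<^esub>" using k by blast
    then show ?thesis using inv[OF k] by simp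
  qed
qed


section \<open>Finite-dimensional commutative algebras\<close>

locale field_algebra = K: field K + A: cring A + V: vectorspace K A
  for K :: "('c, 'r) ring_scheme" and A :: "('c, 'a, 'm) module_scheme" +
  assumes smult_mult: "\<lbrakk>c \<in> carrier K; x \<in> carrier A; y \<in> carrier A\<rbrakk> \<Longrightarrow> (c \<odot>\<^bsub>A\<^esub> x) \<otimes>\<^bsub>A\<^esub> y = c \<odot>\<^bsub>A\<^esub> (x \<otimes>\<^bsub>A\<^esub> y)"
begin

lemma ideal_submodule: assumes "ideal J A" shows "submodule K J A"
proof -
  interpret J: ideal J A by fact
  show ?thesis
  proof (rule submodule.intro)
    fix c v assume "c \<in> carrier K" "v \<in> J"
    then have "(c \<odot>\<^bsub>A\<^esub> \<one>\<^bsub>A\<^esub>) \<otimes>\<^bsub>A\<^esub> v \<in> J" "(c \<odot>\<^bsub>A\<^esub> \<one>\<^bsub>A\<^esub>) \<otimes>\<^bsub>A\<^esub> v = c \<odot>\<^bsub>A\<^esub> v"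
      using J.I_l_closed[of v "c \<odot>\<^bsub>A\<^esub> \<one>\<^bsub>A\<^esub>"] J.a_subset by (auto simp: smult_mult)
    then show "c \<odot>\<^bsub>A\<^esub> v \<in> J" by simp
  qed (use J.a_subset in \<open>auto simp: V.module_axioms\<close>)
qed

lemma submodule_vs: "submodule K W A \<Longrightarrow> vectorspace K (A\<lparr>carrier := W\<rparr>)"
  using V.submodule_is_module by (simp add: vectorspace_def K.field_axioms)

lemma linear_map_coset:
  assumes "submodule K W A"
  shows "linear_map K A (quot_module A W) (\<lambda>x. W +>\<^bsub>A\<^esub> x)"
  using V.quot_module_hom[OF assms] V.quot_module_module[OF assms]
  by (simp add: linear_map_def vectorspace_def V.module_axioms K.field_axioms mod_hom_def)

section \<open>Quotient algebras and annihilators\<close>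

lemma quot_module_mult:
  assumes "ideal q A" "x \<in> carrier A" "y \<in> carrier A"
  shows "(q +>\<^bsub>A\<^esub> x) \<otimes>\<^bsub>quot_module A q\<^esub> (q +>\<^bsub>A\<^esub> y) = q +>\<^bsub>A\<^esub> (x \<otimes>\<^bsub>A\<^esub> y)"
  using ideal.rcoset_mult_add[OF assms] by (simp add: quot_module_def)

lemma quot_module_cring:
  assumes q: "ideal q A"
  shows "cring (quot_module A q)"
proof (rule cringI)
  note sub = ideal_submodule[OF q]
  note ops = quot_module_mult[OF q] V.quot_module_add[OF sub]
  interpret B: Module.module K "quot_module A q" using V.quot_module_module[OF sub] .
  show "abelian_group (quot_module A q)" by (rule B.abelian_group_axioms)
  show "comm_monoid (quot_module A q)"
    by (rule comm_monoidI) (auto simp: ops A.m_ac quot_module_one)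
  show "(X \<oplus>\<^bsub>quot_module A q\<^esub> Y) \<otimes>\<^bsub>quot_module A q\<^esub> Z = (X \<otimes>\<^bsub>quot_module A q\<^esub> Z) \<oplus>\<^bsub>quot_module A q\<^esub> (Y \<otimes>\<^bsub>quot_module A q\<^esub> Z)"
    if "X \<in> carrier (quot_module A q)" "Y \<in> carrier (quot_module A q)" "Z \<in> carrier (quot_module A q)" for X Y Z
    using that by (auto simp: ops A.l_distr)
qed

lemma quot_module_ring_hom:
  assumes q: "ideal q A"
  shows "ring_hom_cring A (quot_module A q) (\<lambda>x. q +>\<^bsub>A\<^esub> x)"
proof -
  have "(\<lambda>x. q +>\<^bsub>A\<^esub> x) \<in> Ring.ring_hom A (quot_module A q)"
    by (rule ring_hom_memI)
      (auto simp: quot_module_mult[OF q] quot_module_one V.quot_module_add[OF ideal_submodule[OF q]])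
  then show ?thesis
    using quot_module_cring[OF q]
    by (simp add: ring_hom_cring_def ring_hom_cring_axioms_def A.is_cring)
qed

lemma quot_module_field_algebra:
  assumes q: "ideal q A"
  shows "field_algebra K (quot_module A q)"
proof -
  note sub = ideal_submodule[OF q]
  have "(c \<odot>\<^bsub>quot_module A q\<^esub> X) \<otimes>\<^bsub>quot_module A q\<^esub> Y = c \<odot>\<^bsub>quot_module A q\<^esub> (X \<otimes>\<^bsub>quot_module A q\<^esub> Y)"
    if c: "c \<in> carrier K" and X: "X \<in> carrier (quot_module A q)" and Y: "Y \<in> carrier (quot_module A q)" for c X Y
  proof -
    obtain x y where "x \<in> carrier A" "y \<in> carrier A" "X = q +>\<^bsub>A\<^esub> x" "Y = q +>\<^bsub>A\<^esub> y" using X Y by auto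
    then show ?thesis
      using c by (simp add: V.quot_module_smult[OF sub] quot_module_mult[OF q] smult_mult)
  qed
  then show ?thesis
    using quot_module_cring[OF q] V.quot_module_module[OF sub]
    by (simp add: field_algebra_def field_algebra_axioms_def vectorspace_def K.field_axioms)
qed

lemma ideal_annihilator:
  assumes "X \<subseteq> carrier A"
  shows "ideal {x \<in> carrier A. \<forall>y\<in>X. y \<otimes>\<^bsub>A\<^esub> x = \<zero>\<^bsub>A\<^esub>} A"
proof (rule idealI[OF A.ring_axioms])
  have XA: "y \<in> carrier A" if "y \<in> X" for y using that assms by auto
  show "subgroup {x \<in> carrier A. \<forall>y\<in>X. y \<otimes>\<^bsub>A\<^esub> x = \<zero>\<^bsub>A\<^esub>} (add_monoid A)"
    using XA by (intro A.add.subgroupI) (auto simp: A.r_distr A.r_minus simp flip: a_inv_def)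
  fix a x assume a: "a \<in> {x \<in> carrier A. \<forall>y\<in>X. y \<otimes>\<^bsub>A\<^esub> x = \<zero>\<^bsub>A\<^esub>}" and x: "x \<in> carrier A"
  have "y \<otimes>\<^bsub>A\<^esub> (x \<otimes>\<^bsub>A\<^esub> a) = \<zero>\<^bsub>A\<^esub>" if "y \<in> X" for y
    using A.m_lcomm[of y x a] a x XA[OF that] that by auto
  moreover have "a \<otimes>\<^bsub>A\<^esub> x = x \<otimes>\<^bsub>A\<^esub> a" using a x by (simp add: A.m_comm)
  ultimately show "x \<otimes>\<^bsub>A\<^esub> a \<in> {x \<in> carrier A. \<forall>y\<in>X. y \<otimes>\<^bsub>A\<^esub> x = \<zero>\<^bsub>A\<^esub>}"
    "a \<otimes>\<^bsub>A\<^esub> x \<in> {x \<in> carrier A. \<forall>y\<in>X. y \<otimes>\<^bsub>A\<^esub> x = \<zero>\<^bsub>A\<^esub>}"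
    using a x by auto
qed

text \<open>The quotient is local because every element of \<open>m\<close> becomes nilpotent: a
  maximal ideal is prime, so it contains all nilpotents and hence the image of \<open>m\<close>,
  which is itself maximal. This evaluates the definite description inside
  \<open>local_socle\<close>.\<close>

lemma the_maximalideal_quot_module:
  assumes q: "ideal q A" and m: "maximalideal m A" and qm: "q \<subseteq> m"
    and nil: "\<And>y. y \<in> m \<Longrightarrow> \<exists>n::nat. y [^]\<^bsub>A\<^esub> n \<in> q"
  shows "(THE N. maximalideal N (quot_module A q)) = (\<lambda>x. q +>\<^bsub>A\<^esub> x) ` m"
proof -
  let ?B = "quot_module A q" and ?p = "\<lambda>x. q +>\<^bsub>A\<^esub> x"
  interpret q: ideal q A by fact
  interpret m: maximalideal m A by fact
  interpret h: ring_hom_cring A ?B ?p using quot_module_ring_hom[OF q] .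
  have hr: "ring_hom_ring A ?B ?p" by (intro ring_hom_ringI2 A.ring_axioms h.S.ring_axioms h.homh)
  note sub = ideal_submodule[OF q]
  \<comment> \<open>Since \<open>q \<subseteq> m\<close>, the ideal \<open>m\<close> is a union of
    cosets of \<open>q\<close>, so membership can be tested on images.\<close>
  have mem: "x \<in> m" if x: "x \<in> carrier A" "?p x \<in> ?p ` m" for x
  proof -
    obtain y where y: "y \<in> m" "?p x = ?p y" using x(2) by auto
    have yA: "y \<in> carrier A" using y m.a_subset by auto
    have "x \<ominus>\<^bsub>A\<^esub> y \<in> m" using V.coset_eq_iff[OF sub x(1) yA] y(2) qm by auto
    then have "(x \<ominus>\<^bsub>A\<^esub> y) \<oplus>\<^bsub>A\<^esub> y \<in> m" using y by auto
    then show ?thesis using x(1) yA by (simp add: a_minus_def A.a_assoc A.l_neg)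
  qed
  have one_m: "\<one>\<^bsub>A\<^esub> \<notin> m" using m.one_imp_carrier m.I_notcarr by auto
  have pm: "ideal (?p ` m) ?B"
  proof (rule idealI[OF h.S.ring_axioms])
    show "subgroup (?p ` m) (add_monoid ?B)"
      by (rule ring_hom_ring.img_is_add_subgroup[OF hr m.a_subgroup])
  next
    fix Y X assume "Y \<in> ?p ` m" "X \<in> carrier ?B"
    then obtain y x where yx: "y \<in> m" "x \<in> carrier A" "Y = ?p y" "X = ?p x" by auto
    have "x \<otimes>\<^bsub>A\<^esub> y \<in> m" "y \<otimes>\<^bsub>A\<^esub> x \<in> m"
      using m.I_l_closed[OF yx(1,2)] m.I_r_closed[OF yx(1,2)] by auto
    moreover have "y \<in> carrier A" using yx(1) m.a_subset by auto
    ultimately show "X \<otimes>\<^bsub>?B\<^esub> Y \<in> ?p ` m" "Y \<otimes>\<^bsub>?B\<^esub> X \<in> ?p ` m"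
      unfolding yx(3,4) using yx(2) by (simp_all add: quot_module_mult[OF q] image_eqI del: h.hom_mult)
  qed
  have max: "maximalideal (?p ` m) ?B"
  proof (rule maximalidealI[OF pm])
    show "carrier ?B \<noteq> ?p ` m"
      using mem[of "\<one>\<^bsub>A\<^esub>"] one_m by (metis A.one_closed h.hom_closed)
    fix N assume N: "ideal N ?B" "?p ` m \<subseteq> N" "N \<subseteq> carrier ?B"
    let ?N = "{r \<in> carrier A. ?p r \<in> N}"
    have "?N = m \<or> ?N = carrier A"
      using ring_hom_ring.ideal_vimage[OF hr N(1)] N(2) m.a_subset by (intro m.I_maximal) auto
    moreover have "N = ?p ` ?N" using N(3) by auto
    ultimately show "N = ?p ` m \<or> N = carrier ?B" by auto
  qed
  moreover have "N = ?p ` m" if N: "maximalideal N ?B" for N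
  proof -
    interpret N: maximalideal N ?B by fact
    interpret Np: primeideal N ?B using h.S.maximalideal_prime[OF N] .
    have "?p y \<in> N" if y: "y \<in> m" for y
    proof -
      have yA: "y \<in> carrier A" using y m.a_subset by auto
      \<comment> \<open>Primeness strips one factor at a time; exponent 0 would put the unit into
        the proper ideal \<open>N\<close>.\<close>
      have "?p (y [^]\<^bsub>A\<^esub> n) \<in> N \<Longrightarrow> ?p y \<in> N" for n :: nat
      proof (induction n)
        case 0
        then have "\<one>\<^bsub>?B\<^esub> \<in> N" by simp
        then show ?case using N.one_imp_carrier N.I_notcarr by auto
      next
        case (Suc n)
        then have "?p (y [^]\<^bsub>A\<^esub> n) \<otimes>\<^bsub>?B\<^esub> ?p y \<in> N" using yA by simp
        then show ?case using Suc.IH Np.I_prime[of "?p (y [^]\<^bsub>A\<^esub> n)" "?p y"] yA by auto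
      qed
      moreover obtain n :: nat where "y [^]\<^bsub>A\<^esub> n \<in> q" using nil[OF y] by auto
      then have "?p (y [^]\<^bsub>A\<^esub> n) = \<zero>\<^bsub>?B\<^esub>" using V.coset_eq_self_iff[OF sub] yA by simp
      then have "?p (y [^]\<^bsub>A\<^esub> n) \<in> N" using N.zero_closed by metis
      ultimately show ?thesis by blast
    qed
    then show ?thesis
      using maximalideal.I_maximal[OF max N.ideal_axioms] N.a_subset N.I_notcarr by auto
  qed
  ultimately show ?thesis by (rule the_equality)
qed

lemma local_socle_quot_module_iff:
  assumes q: "ideal q A" and m: "maximalideal m A" and qm: "q \<subseteq> m"
    and nil: "\<And>y. y \<in> m \<Longrightarrow> \<exists>n::nat. y [^]\<^bsub>A\<^esub> n \<in> q"
    and x: "x \<in> carrier A"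
  shows "q +>\<^bsub>A\<^esub> x \<in> local_socle (quot_module A q) \<longleftrightarrow> (\<forall>y\<in>m. y \<otimes>\<^bsub>A\<^esub> x \<in> q)"
proof -
  interpret m: maximalideal m A by fact
  have mA: "y \<in> carrier A" if "y \<in> m" for y using that m.a_subset by auto
  show ?thesis
    using x mA by (auto simp: local_socle_def the_maximalideal_quot_module[OF q m qm nil]
        quot_module_mult[OF q] V.coset_eq_self_iff[OF ideal_submodule[OF q]])
qed

text \<open>Coefficient tuples correspond to elements g of \<open>S\<close>, and the relation they
  impose in row j says that a representative of \<open>e j\<close> multiplies g into
  \<open>F\<close>. Hypothesis \<open>X\<close> covers every representative, so the proof may fix
  one choice \<open>E j\<close>. Because \<open>F\<close> is only a subspace, the combined rows give
  a condition on the ideal generated by g, not on g alone.\<close>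

lemma columns_lin_indpt_iff:
  assumes m: "ideal m A" and S: "ideal S A" and F: "submodule K F A"
    and kill: "\<And>y x. y \<in> m \<Longrightarrow> x \<in> S \<Longrightarrow> y \<otimes>\<^bsub>A\<^esub> x = \<zero>\<^bsub>A\<^esub>"
    and e: "basis_tuple K (quot_module A m) l e"
    and f: "basis_tuple K (A\<lparr>carrier := S\<rparr>) N f"
    and X: "\<And>j k a. \<lbrakk>j \<in> {1..l}; k \<in> {1..N}; a \<in> carrier A; e j = m +>\<^bsub>A\<^esub> a\<rbrakk> \<Longrightarrow> X j k = F +>\<^bsub>A\<^esub> (a \<otimes>\<^bsub>A\<^esub> f k)"
  shows "columns_lin_indpt K (quot_module A F) l N X \<longleftrightarrow>
    (\<forall>g\<in>S. g \<noteq> \<zero>\<^bsub>A\<^esub> \<longrightarrow> \<not> PIdl\<^bsub>A\<^esub> g \<subseteq> F)"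
proof -
  interpret m: ideal m A by fact
  interpret S: ideal S A by fact
  interpret F: submodule K F A by fact
  note msub = ideal_submodule[OF m] and Ssub = ideal_submodule[OF S]
  interpret L: linear_map K A "quot_module A m" "\<lambda>x. m +>\<^bsub>A\<^esub> x" using linear_map_coset[OF msub] .
  interpret G: linear_map K A "quot_module A F" "\<lambda>x. F +>\<^bsub>A\<^esub> x" using linear_map_coset[OF F] .
  have Fm: "abelian_monoid (quot_module A F)" and mm: "abelian_monoid (quot_module A m)"
    using V.quot_module_module[OF F] V.quot_module_module[OF msub]
    by (simp_all add: Module.module_def abelian_group_def)
  note e' = basis_tuple_expand[OF L.W.vectorspace_axioms e]
  note f' = basis_tuple_expand[OF submodule_vs[OF Ssub] f]
  have SA: "x \<in> carrier A" if "x \<in> S" for x using that S.a_subset by auto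
  have "\<forall>j\<in>{1..l}. \<exists>a\<in>carrier A. e j = m +>\<^bsub>A\<^esub> a" using e'(1) by auto
  then obtain E where E: "\<And>j. j \<in> {1..l} \<Longrightarrow> E j \<in> carrier A" "\<And>j. j \<in> {1..l} \<Longrightarrow> e j = m +>\<^bsub>A\<^esub> E j"
    by metis
  have fS: "f k \<in> S" if "k \<in> {1..N}" for k using f'(1) that by auto
  have Ssum: "(\<Oplus>\<^bsub>A\<lparr>carrier := S\<rparr>\<^esub>k\<in>{1..N}. c k \<odot>\<^bsub>A\<lparr>carrier := S\<rparr>\<^esub> f k) = (\<Oplus>\<^bsub>A\<^esub>k\<in>{1..N}. c k \<odot>\<^bsub>A\<^esub> f k)"
    if "c \<in> {1..N} \<rightarrow> carrier K" for c
    using V.finsum_submodule[OF Ssub, of "{1..N}" "\<lambda>k. c k \<odot>\<^bsub>A\<^esub> f k"] that fS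
      submodule.smult_closed[OF Ssub] by (simp add: Pi_iff)
  have sum_S: "(\<Oplus>\<^bsub>A\<^esub>k\<in>{1..N}. c k \<odot>\<^bsub>A\<^esub> f k) \<in> S" if c: "c \<in> {1..N} \<rightarrow> carrier K" for c
  proof -
    interpret SV: vectorspace K "A\<lparr>carrier := S\<rparr>" using submodule_vs[OF Ssub] .
    have "(\<Oplus>\<^bsub>A\<lparr>carrier := S\<rparr>\<^esub>k\<in>{1..N}. c k \<odot>\<^bsub>A\<^esub> f k) \<in> carrier (A\<lparr>carrier := S\<rparr>)"
      using c fS by (intro SV.M.finsum_closed) (auto intro!: submodule.smult_closed[OF Ssub] simp: Pi_iff)
    then show ?thesis using Ssum[OF c] by simp
  qed
  have row: "(\<Oplus>\<^bsub>quot_module A F\<^esub>k\<in>{1..N}. c k \<odot>\<^bsub>quot_module A F\<^esub> X j k) = \<zero>\<^bsub>quot_module A F\<^esub>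
      \<longleftrightarrow> E j \<otimes>\<^bsub>A\<^esub> (\<Oplus>\<^bsub>A\<^esub>k\<in>{1..N}. c k \<odot>\<^bsub>A\<^esub> f k) \<in> F"
    if c: "c \<in> {1..N} \<rightarrow> carrier K" and j: "j \<in> {1..l}" for c j
  proof -
    have cK: "c k \<in> carrier K" if "k \<in> {1..N}" for k using c that by auto
    have "(\<Oplus>\<^bsub>quot_module A F\<^esub>k\<in>{1..N}. c k \<odot>\<^bsub>quot_module A F\<^esub> X j k)
        = (\<Oplus>\<^bsub>quot_module A F\<^esub>k\<in>{1..N}. F +>\<^bsub>A\<^esub> (E j \<otimes>\<^bsub>A\<^esub> (c k \<odot>\<^bsub>A\<^esub> f k)))"
    proof (rule abelian_monoid.finsum_cong'[OF Fm refl])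
      fix k assume k: "k \<in> {1..N}"
      have "E j \<otimes>\<^bsub>A\<^esub> (c k \<odot>\<^bsub>A\<^esub> f k) = c k \<odot>\<^bsub>A\<^esub> (E j \<otimes>\<^bsub>A\<^esub> f k)"
        using smult_mult[OF cK[OF k] SA[OF fS[OF k]] E(1)[OF j]] cK[OF k] SA[OF fS[OF k]] E(1)[OF j]
        by (simp add: A.m_comm)
      then show "c k \<odot>\<^bsub>quot_module A F\<^esub> X j k = F +>\<^bsub>A\<^esub> (E j \<otimes>\<^bsub>A\<^esub> (c k \<odot>\<^bsub>A\<^esub> f k))"
        using V.quot_module_smult[OF F cK[OF k], of "E j \<otimes>\<^bsub>A\<^esub> f k"] E[OF j] SA[OF fS[OF k]] X[OF j k E(1)[OF j] E(2)[OF j]]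
        by simp
    qed (use E(1)[OF j] SA fS cK in auto)
    also have "\<dots> = F +>\<^bsub>A\<^esub> (\<Oplus>\<^bsub>A\<^esub>k\<in>{1..N}. E j \<otimes>\<^bsub>A\<^esub> (c k \<odot>\<^bsub>A\<^esub> f k))"
      using E(1)[OF j] SA fS cK by (intro G.hom_finsum[symmetric]) auto
    also have "(\<Oplus>\<^bsub>A\<^esub>k\<in>{1..N}. E j \<otimes>\<^bsub>A\<^esub> (c k \<odot>\<^bsub>A\<^esub> f k)) = E j \<otimes>\<^bsub>A\<^esub> (\<Oplus>\<^bsub>A\<^esub>k\<in>{1..N}. c k \<odot>\<^bsub>A\<^esub> f k)"
      using E(1)[OF j] SA fS cK by (intro A.finsum_rdistr[symmetric]) auto
    finally show ?thesis
      using V.coset_eq_self_iff[OF F] E(1)[OF j] SA[OF sum_S[OF c]] by simp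
  qed
  have rows: "(\<forall>j\<in>{1..l}. E j \<otimes>\<^bsub>A\<^esub> g \<in> F) \<longleftrightarrow> PIdl\<^bsub>A\<^esub> g \<subseteq> F" if g: "g \<in> S" for g
  proof
    assume EF: "\<forall>j\<in>{1..l}. E j \<otimes>\<^bsub>A\<^esub> g \<in> F"
    have "r \<otimes>\<^bsub>A\<^esub> g \<in> F" if r: "r \<in> carrier A" for r
    proof -
      obtain d where d: "d \<in> {1..l} \<rightarrow> carrier K"
        "m +>\<^bsub>A\<^esub> r = (\<Oplus>\<^bsub>quot_module A m\<^esub>j\<in>{1..l}. d j \<odot>\<^bsub>quot_module A m\<^esub> e j)"
        using e'(2)[of "m +>\<^bsub>A\<^esub> r"] r by auto
      have dK: "d j \<in> carrier K" if "j \<in> {1..l}" for j using d(1) that by auto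
      let ?t = "\<Oplus>\<^bsub>A\<^esub>j\<in>{1..l}. d j \<odot>\<^bsub>A\<^esub> E j"
      have t: "?t \<in> carrier A" using E(1) dK by (intro A.finsum_closed) auto
      have "(\<Oplus>\<^bsub>quot_module A m\<^esub>j\<in>{1..l}. d j \<odot>\<^bsub>quot_module A m\<^esub> e j)
          = (\<Oplus>\<^bsub>quot_module A m\<^esub>j\<in>{1..l}. m +>\<^bsub>A\<^esub> (d j \<odot>\<^bsub>A\<^esub> E j))"
        using E dK by (intro abelian_monoid.finsum_cong'[OF mm refl]) auto
      also have "\<dots> = m +>\<^bsub>A\<^esub> ?t"
        using E(1) dK by (intro L.hom_finsum[symmetric]) auto
      finally have rt: "r \<ominus>\<^bsub>A\<^esub> ?t \<in> m" using V.coset_eq_iff[OF msub r t] d(2) by simp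
      \<comment> \<open>Modulo \<open>m\<close> the element r is a K-combination of the
        \<open>E j\<close>; the error term lies in \<open>m\<close> and annihilates g.\<close>
      have "r \<otimes>\<^bsub>A\<^esub> g = (r \<ominus>\<^bsub>A\<^esub> ?t) \<otimes>\<^bsub>A\<^esub> g \<oplus>\<^bsub>A\<^esub> ?t \<otimes>\<^bsub>A\<^esub> g"
        using r t SA[OF g] by (simp add: a_minus_def A.l_distr A.a_assoc A.l_minus A.l_neg)
      also have "\<dots> = ?t \<otimes>\<^bsub>A\<^esub> g" using kill[OF rt g] t SA[OF g] by simp
      also have "\<dots> = (\<Oplus>\<^bsub>A\<^esub>j\<in>{1..l}. (d j \<odot>\<^bsub>A\<^esub> E j) \<otimes>\<^bsub>A\<^esub> g)"
        using E(1) dK SA[OF g] by (intro A.finsum_ldistr) auto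
      also have "\<dots> = (\<Oplus>\<^bsub>A\<^esub>j\<in>{1..l}. d j \<odot>\<^bsub>A\<^esub> (E j \<otimes>\<^bsub>A\<^esub> g))"
        using E(1) dK SA[OF g] by (intro A.finsum_cong'[OF refl]) (auto simp: smult_mult)
      \<comment> \<open>Rewriting the sum inside the subspace makes closure of its carrier under
        sums yield membership in \<open>F\<close>.\<close>
      also have "\<dots> = (\<Oplus>\<^bsub>A\<lparr>carrier := F\<rparr>\<^esub>j\<in>{1..l}. d j \<odot>\<^bsub>A\<^esub> (E j \<otimes>\<^bsub>A\<^esub> g))"
        using EF dK by (intro V.finsum_submodule[OF F, symmetric]) auto
      also have "\<dots> \<in> F"
      proof -
        interpret FV: vectorspace K "A\<lparr>carrier := F\<rparr>" using submodule_vs[OF F] .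
        show ?thesis
          using FV.M.finsum_closed[of "\<lambda>j. d j \<odot>\<^bsub>A\<^esub> (E j \<otimes>\<^bsub>A\<^esub> g)" "{1..l}"] EF dK by (auto simp: Pi_iff)
      qed
      finally show ?thesis .
    qed
    then show "PIdl\<^bsub>A\<^esub> g \<subseteq> F" by (auto simp: cgenideal_def)
  next
    assume "PIdl\<^bsub>A\<^esub> g \<subseteq> F"
    then show "\<forall>j\<in>{1..l}. E j \<otimes>\<^bsub>A\<^esub> g \<in> F" using E(1) unfolding cgenideal_def by blast
  qed
  have cols: "(\<forall>j\<in>{1..l}. (\<Oplus>\<^bsub>quot_module A F\<^esub>k\<in>{1..N}. c k \<odot>\<^bsub>quot_module A F\<^esub> X j k) = \<zero>\<^bsub>quot_module A F\<^esub>)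
      \<longleftrightarrow> PIdl\<^bsub>A\<^esub> (\<Oplus>\<^bsub>A\<^esub>k\<in>{1..N}. c k \<odot>\<^bsub>A\<^esub> f k) \<subseteq> F" if c: "c \<in> {1..N} \<rightarrow> carrier K" for c
    unfolding rows[OF sum_S[OF c], symmetric] by (intro ball_cong refl row[OF c])
  have "columns_lin_indpt K (quot_module A F) l N X \<longleftrightarrow>
    (\<forall>c \<in> {1..N} \<rightarrow> carrier K. PIdl\<^bsub>A\<^esub> (\<Oplus>\<^bsub>A\<^esub>k\<in>{1..N}. c k \<odot>\<^bsub>A\<^esub> f k) \<subseteq> F \<longrightarrow> (\<forall>k\<in>{1..N}. c k = \<zero>\<^bsub>K\<^esub>))"
    unfolding columns_lin_indpt_def by (intro ball_cong refl) (simp only: cols)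
  also have "\<dots> \<longleftrightarrow> (\<forall>g\<in>S. g \<noteq> \<zero>\<^bsub>A\<^esub> \<longrightarrow> \<not> PIdl\<^bsub>A\<^esub> g \<subseteq> F)"
  proof (intro iffI ballI impI notI)
    fix g assume *: "\<forall>c \<in> {1..N} \<rightarrow> carrier K. PIdl\<^bsub>A\<^esub> (\<Oplus>\<^bsub>A\<^esub>k\<in>{1..N}. c k \<odot>\<^bsub>A\<^esub> f k) \<subseteq> F \<longrightarrow> (\<forall>k\<in>{1..N}. c k = \<zero>\<^bsub>K\<^esub>)"
      and g: "g \<in> S" "g \<noteq> \<zero>\<^bsub>A\<^esub>" "PIdl\<^bsub>A\<^esub> g \<subseteq> F"
    obtain c where c: "c \<in> {1..N} \<rightarrow> carrier K" "g = (\<Oplus>\<^bsub>A\<^esub>k\<in>{1..N}. c k \<odot>\<^bsub>A\<^esub> f k)"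
      using f'(2)[of g] g(1) Ssum by auto
    then have "\<forall>k\<in>{1..N}. c k = \<zero>\<^bsub>K\<^esub>" using * g(3) by blast
    then have "(\<Oplus>\<^bsub>A\<^esub>k\<in>{1..N}. c k \<odot>\<^bsub>A\<^esub> f k) = \<zero>\<^bsub>A\<^esub>"
      using fS SA by (intro A.add.finprod_one_eqI) auto
    then show False using g(2) c(2) by simp
  next
    fix c k assume *: "\<forall>g\<in>S. g \<noteq> \<zero>\<^bsub>A\<^esub> \<longrightarrow> \<not> PIdl\<^bsub>A\<^esub> g \<subseteq> F" and c: "c \<in> {1..N} \<rightarrow> carrier K"
      and P: "PIdl\<^bsub>A\<^esub> (\<Oplus>\<^bsub>A\<^esub>k\<in>{1..N}. c k \<odot>\<^bsub>A\<^esub> f k) \<subseteq> F" and k: "k \<in> {1..N}"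
    have "(\<Oplus>\<^bsub>A\<^esub>k\<in>{1..N}. c k \<odot>\<^bsub>A\<^esub> f k) = \<zero>\<^bsub>A\<^esub>" using * sum_S[OF c] P by blast
    then show "c k = \<zero>\<^bsub>K\<^esub>" using f'(3)[OF c _ k] Ssum[OF c] by simp
  qed
  finally show ?thesis .
qed

end

section \<open>Consequences of finite dimension: minimal ideals, maximality of primes, socle
  elements\<close>

locale fin_dim_algebra = field_algebra K A
  for K :: "('c, 'r) ring_scheme" and A :: "('c, 'a, 'm) module_scheme" +
  assumes fin_dim: "V.fin_dim"
begin

text \<open>Here \<open>U\<close> is regarded as a subspace of the vector space \<open>W\<close>, to
  which the equality case of the dimension bound applies.\<close>

lemma submodule_dim_eq:
  assumes "submodule K W A" "submodule K U A" "U \<subseteq> W"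
    "vectorspace.dim K (A\<lparr>carrier := W\<rparr>) \<le> vectorspace.dim K (A\<lparr>carrier := U\<rparr>)"
  shows "U = W"
proof -
  interpret W: vectorspace K "A\<lparr>carrier := W\<rparr>" using submodule_vs[OF assms(1)] .
  have fd: "W.fin_dim" using V.submodule_dim(1)[OF fin_dim assms(1)] .
  have U: "submodule K U (A\<lparr>carrier := W\<rparr>)"
    using assms(2,3) W.module_axioms by (auto simp: submodule_def)
  show ?thesis
    using W.submodule_dim(2,3)[OF fd U] assms(4) by simp
qed

text \<open>This is the Artinian property. A member of least dimension works, because a smaller
  member would have at least the same dimension and therefore coincide with it.\<close>

lemma ex_minimal_ideal:
  assumes "\<J> \<noteq> {}" "\<And>J. J \<in> \<J> \<Longrightarrow> ideal J A"
  obtains J where "J \<in> \<J>" "\<And>J'. J' \<in> \<J> \<Longrightarrow> J' \<subseteq> J \<Longrightarrow> J' = J"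
proof -
  let ?d = "\<lambda>J. vectorspace.dim K (A\<lparr>carrier := J\<rparr>)"
  obtain J where J: "J \<in> \<J>" "\<And>J'. J' \<in> \<J> \<Longrightarrow> ?d J \<le> ?d J'"
    using assms(1) ex_has_least_nat[of "\<lambda>J. J \<in> \<J>" _ ?d] by blast
  show ?thesis
    using J assms(2) submodule_dim_eq[OF ideal_submodule ideal_submodule] by (intro that[of J]) auto
qed

text \<open>For a outside \<open>M\<close> the descending ideals \<open>M + (a^n)\<close> become
  stationary, which gives \<open>a^n (1 - r a) \<in> M\<close> for some r. No power of a lies in
  \<open>M\<close>, so \<open>1 - r a \<in> M\<close>, and an ideal containing both \<open>M\<close>
  and a contains 1.\<close>

lemma primeideal_imp_maximalideal:
  assumes "primeideal M A" shows "maximalideal M A"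
proof -
  interpret M: primeideal M A by fact
  have "J = carrier A" if J: "ideal J A" "M \<subseteq> J" "J \<noteq> M" for J
  proof -
    interpret J: ideal J A by fact
    obtain a where a: "a \<in> J" "a \<notin> M" using J by blast
    have aA: "a \<in> carrier A" using a(1) J.a_subset by auto
    have pow: "a [^]\<^bsub>A\<^esub> n \<notin> M" for n :: nat
    proof (induction n)
      case 0
      then show ?case using M.one_imp_carrier M.I_notcarr by auto
    next
      case (Suc n)
      then show ?case using M.I_prime[of "a [^]\<^bsub>A\<^esub> n" a] a aA by auto
    qed
    let ?U = "\<lambda>n::nat. M <+>\<^bsub>A\<^esub> PIdl\<^bsub>A\<^esub> (a [^]\<^bsub>A\<^esub> n)"
    have U_iff: "x \<in> ?U n \<longleftrightarrow> (\<exists>h\<in>M. \<exists>r\<in>carrier A. x = h \<oplus>\<^bsub>A\<^esub> r \<otimes>\<^bsub>A\<^esub> (a [^]\<^bsub>A\<^esub> n))" for x n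
      by (auto simp: set_add_def' cgenideal_def)
    have U: "ideal (?U n) A" for n
      using aA by (intro A.add_ideals A.cgenideal_ideal M.ideal_axioms) auto
    obtain J0 where J0: "J0 \<in> range ?U" "\<And>J'. J' \<in> range ?U \<Longrightarrow> J' \<subseteq> J0 \<Longrightarrow> J' = J0"
      by (rule ex_minimal_ideal[of "range ?U"]) (use U in auto)
    then obtain n where n: "J0 = ?U n" by auto
    have "?U (Suc n) \<subseteq> ?U n"
    proof
      fix x assume "x \<in> ?U (Suc n)"
      then obtain h r where x: "h \<in> M" "r \<in> carrier A" "x = h \<oplus>\<^bsub>A\<^esub> r \<otimes>\<^bsub>A\<^esub> (a [^]\<^bsub>A\<^esub> Suc n)"
        unfolding U_iff by blast
      then have "x = h \<oplus>\<^bsub>A\<^esub> (r \<otimes>\<^bsub>A\<^esub> a) \<otimes>\<^bsub>A\<^esub> (a [^]\<^bsub>A\<^esub> n)"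
        using aA by (simp add: A.m_ac)
      then show "x \<in> ?U n" using x(1,2) aA unfolding U_iff by blast
    qed
    then have eq: "?U (Suc n) = ?U n" using J0(2)[of "?U (Suc n)"] unfolding n by blast
    have "a [^]\<^bsub>A\<^esub> n = \<zero>\<^bsub>A\<^esub> \<oplus>\<^bsub>A\<^esub> \<one>\<^bsub>A\<^esub> \<otimes>\<^bsub>A\<^esub> (a [^]\<^bsub>A\<^esub> n)" using aA by simp
    then have "a [^]\<^bsub>A\<^esub> n \<in> ?U n" unfolding U_iff using M.zero_closed A.one_closed by blast
    then obtain h r where r: "h \<in> M" "r \<in> carrier A" "a [^]\<^bsub>A\<^esub> n = h \<oplus>\<^bsub>A\<^esub> r \<otimes>\<^bsub>A\<^esub> (a [^]\<^bsub>A\<^esub> Suc n)"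
      unfolding eq[symmetric] U_iff by blast
    have hA: "h \<in> carrier A" using r M.a_subset by auto
    have "a [^]\<^bsub>A\<^esub> n \<otimes>\<^bsub>A\<^esub> (\<one>\<^bsub>A\<^esub> \<ominus>\<^bsub>A\<^esub> r \<otimes>\<^bsub>A\<^esub> a) = a [^]\<^bsub>A\<^esub> n \<ominus>\<^bsub>A\<^esub> r \<otimes>\<^bsub>A\<^esub> (a [^]\<^bsub>A\<^esub> Suc n)"
      using aA r(2) by (simp add: a_minus_def A.r_distr A.r_minus A.m_ac)
    also have "\<dots> = h"
      using aA hA r(2) by (subst r(3)) (simp add: a_minus_def A.a_assoc A.r_neg)
    finally have "a [^]\<^bsub>A\<^esub> n \<otimes>\<^bsub>A\<^esub> (\<one>\<^bsub>A\<^esub> \<ominus>\<^bsub>A\<^esub> r \<otimes>\<^bsub>A\<^esub> a) \<in> M" using r(1) by (simp only:)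
    then have "\<one>\<^bsub>A\<^esub> \<ominus>\<^bsub>A\<^esub> r \<otimes>\<^bsub>A\<^esub> a \<in> M"
      using M.I_prime[of "a [^]\<^bsub>A\<^esub> n" "\<one>\<^bsub>A\<^esub> \<ominus>\<^bsub>A\<^esub> r \<otimes>\<^bsub>A\<^esub> a"] pow[of n] aA r(1,2) by auto
    then have "(\<one>\<^bsub>A\<^esub> \<ominus>\<^bsub>A\<^esub> r \<otimes>\<^bsub>A\<^esub> a) \<oplus>\<^bsub>A\<^esub> r \<otimes>\<^bsub>A\<^esub> a \<in> J"
      using J(2) a(1) r(2) by (intro J.a_closed J.I_l_closed) auto
    also have "(\<one>\<^bsub>A\<^esub> \<ominus>\<^bsub>A\<^esub> r \<otimes>\<^bsub>A\<^esub> a) \<oplus>\<^bsub>A\<^esub> r \<otimes>\<^bsub>A\<^esub> a = \<one>\<^bsub>A\<^esub>"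
      using aA r(2) by (simp add: a_minus_def A.a_assoc A.l_neg)
    finally show ?thesis by (rule J.one_imp_carrier)
  qed
  then show ?thesis
    using M.I_notcarr by (intro maximalidealI M.ideal_axioms) auto
qed

text \<open>The element g generates a minimal nonzero principal ideal inside \<open>W\<close>. If y
  did not kill it, minimality would give \<open>g = r y g\<close>; iterating makes g a multiple of
  every power of y, against nilpotency of y on \<open>W\<close>.\<close>

lemma ex_socle_element:
  assumes W: "ideal W A" "W \<noteq> {\<zero>\<^bsub>A\<^esub>}" and M: "M \<subseteq> carrier A"
    and nil: "\<And>y. y \<in> M \<Longrightarrow> \<exists>n::nat. \<forall>w\<in>W. y [^]\<^bsub>A\<^esub> n \<otimes>\<^bsub>A\<^esub> w = \<zero>\<^bsub>A\<^esub>"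
  obtains g where "g \<in> W" "g \<noteq> \<zero>\<^bsub>A\<^esub>" "\<And>y. y \<in> M \<Longrightarrow> y \<otimes>\<^bsub>A\<^esub> g = \<zero>\<^bsub>A\<^esub>"
proof -
  interpret W: ideal W A by fact
  let ?J = "(\<lambda>g. PIdl\<^bsub>A\<^esub> g) ` (W - {\<zero>\<^bsub>A\<^esub>})"
  have "?J \<noteq> {}" using W(2) W.zero_closed by auto
  moreover have "ideal J A" if "J \<in> ?J" for J
    using that W.a_subset A.cgenideal_ideal by auto
  ultimately obtain J0 where J0: "J0 \<in> ?J" "\<And>J'. J' \<in> ?J \<Longrightarrow> J' \<subseteq> J0 \<Longrightarrow> J' = J0"
    by (rule ex_minimal_ideal) auto
  then obtain g where g: "g \<in> W" "g \<noteq> \<zero>\<^bsub>A\<^esub>" and Jg: "J0 = PIdl\<^bsub>A\<^esub> g" by auto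
  note min = J0(2)[unfolded Jg]
  have gA: "g \<in> carrier A" using g W.a_subset by auto
  have "y \<otimes>\<^bsub>A\<^esub> g = \<zero>\<^bsub>A\<^esub>" if y: "y \<in> M" for y
  proof (rule ccontr)
    assume nz: "y \<otimes>\<^bsub>A\<^esub> g \<noteq> \<zero>\<^bsub>A\<^esub>"
    have yA: "y \<in> carrier A" using y M by auto
    have "PIdl\<^bsub>A\<^esub> (y \<otimes>\<^bsub>A\<^esub> g) \<subseteq> PIdl\<^bsub>A\<^esub> g"
      using yA gA by (intro A.cgenideal_minimal A.cgenideal_ideal) (auto simp: cgenideal_def)
    then have "PIdl\<^bsub>A\<^esub> (y \<otimes>\<^bsub>A\<^esub> g) = PIdl\<^bsub>A\<^esub> g"
      using nz yA g by (intro min) (auto intro: W.I_l_closed)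
    then have "g \<in> PIdl\<^bsub>A\<^esub> (y \<otimes>\<^bsub>A\<^esub> g)" using A.cgenideal_self[OF gA] by simp
    then obtain r where r: "r \<in> carrier A" "g = r \<otimes>\<^bsub>A\<^esub> (y \<otimes>\<^bsub>A\<^esub> g)"
      by (auto simp: cgenideal_def)
    \<comment> \<open>The cofactor h has to stay in \<open>W\<close>, as powers of y are only known
      to annihilate elements of \<open>W\<close>.\<close>
    have "\<exists>h\<in>W. g = y [^]\<^bsub>A\<^esub> n \<otimes>\<^bsub>A\<^esub> h" for n :: nat
    proof (induction n)
      case 0
      then show ?case using g gA by auto
    next
      case (Suc n)
      then obtain h where h: "h \<in> W" "g = y [^]\<^bsub>A\<^esub> n \<otimes>\<^bsub>A\<^esub> h" by auto
      have hA: "h \<in> carrier A" using h W.a_subset by auto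
      have "g = r \<otimes>\<^bsub>A\<^esub> (y \<otimes>\<^bsub>A\<^esub> (y [^]\<^bsub>A\<^esub> n \<otimes>\<^bsub>A\<^esub> h))"
        using r(2) by (simp only: flip: h(2))
      also have "\<dots> = y [^]\<^bsub>A\<^esub> Suc n \<otimes>\<^bsub>A\<^esub> (r \<otimes>\<^bsub>A\<^esub> h)"
        using r(1) hA yA by (simp add: A.m_ac)
      finally show ?case using W.I_l_closed[OF h(1) r(1)] by blast
    qed
    then show False using nil[OF y] g(2) by metis
  qed
  then show thesis using that g by blast
qed

text \<open>Reduction modulo \<open>M\<close> and multiplication by \<open>f\<close> are linear maps
  on \<open>A\<close> with the same kernel, so rank-nullity gives images of equal dimension. The
  annihilator of \<open>f\<close> equals \<open>M\<close> because it is a proper ideal containing a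
  maximal one.\<close>

lemma dim_cgenideal:
  assumes M: "maximalideal M A" and f: "f \<in> carrier A" "f \<noteq> \<zero>\<^bsub>A\<^esub>"
    and kill: "\<And>y. y \<in> M \<Longrightarrow> y \<otimes>\<^bsub>A\<^esub> f = \<zero>\<^bsub>A\<^esub>"
  shows "vectorspace.dim K (A\<lparr>carrier := PIdl\<^bsub>A\<^esub> f\<rparr>) = vectorspace.dim K (quot_module A M)"
proof -
  interpret M: maximalideal M A by fact
  have Msub: "submodule K M A" and Psub: "submodule K (PIdl\<^bsub>A\<^esub> f) A"
    using ideal_submodule M.ideal_axioms A.cgenideal_ideal[OF f(1)] by auto
  interpret l1: linear_map K A "quot_module A M" "\<lambda>x. M +>\<^bsub>A\<^esub> x"
    using linear_map_coset[OF Msub] .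
  have "mod_hom K A (A\<lparr>carrier := PIdl\<^bsub>A\<^esub> f\<rparr>) (\<lambda>x. x \<otimes>\<^bsub>A\<^esub> f)"
    using f V.submodule_is_module[OF Psub]
    by (auto simp: mod_hom_def mod_hom_axioms_def LinearCombinations.module_hom_def V.module_axioms
        A.l_distr smult_mult cgenideal_def)
  then interpret l2: linear_map K A "A\<lparr>carrier := PIdl\<^bsub>A\<^esub> f\<rparr>" "\<lambda>x. x \<otimes>\<^bsub>A\<^esub> f"
    using submodule_vs[OF Psub] by (simp add: linear_map_def V.vectorspace_axioms)
  have "ideal {x \<in> carrier A. x \<otimes>\<^bsub>A\<^esub> f = \<zero>\<^bsub>A\<^esub>} A"
  proof (rule idealI)
    show "subgroup {x \<in> carrier A. x \<otimes>\<^bsub>A\<^esub> f = \<zero>\<^bsub>A\<^esub>} (add_monoid A)"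
      using f by (intro A.add.subgroupI) (auto simp: A.l_distr A.l_minus simp flip: a_inv_def)
  next
    fix a x assume a: "a \<in> {x \<in> carrier A. x \<otimes>\<^bsub>A\<^esub> f = \<zero>\<^bsub>A\<^esub>}" and x: "x \<in> carrier A"
    have aA: "a \<in> carrier A" using a by auto
    have "x \<otimes>\<^bsub>A\<^esub> a \<otimes>\<^bsub>A\<^esub> f = x \<otimes>\<^bsub>A\<^esub> (a \<otimes>\<^bsub>A\<^esub> f)" "a \<otimes>\<^bsub>A\<^esub> x \<otimes>\<^bsub>A\<^esub> f = x \<otimes>\<^bsub>A\<^esub> (a \<otimes>\<^bsub>A\<^esub> f)"
      using aA x f(1) by (simp_all add: A.m_ac)
    then show "x \<otimes>\<^bsub>A\<^esub> a \<in> {x \<in> carrier A. x \<otimes>\<^bsub>A\<^esub> f = \<zero>\<^bsub>A\<^esub>}" "a \<otimes>\<^bsub>A\<^esub> x \<in> {x \<in> carrier A. x \<otimes>\<^bsub>A\<^esub> f = \<zero>\<^bsub>A\<^esub>}"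
      using a x by auto
  qed (rule A.ring_axioms)
  moreover have "M \<subseteq> {x \<in> carrier A. x \<otimes>\<^bsub>A\<^esub> f = \<zero>\<^bsub>A\<^esub>}" using kill M.a_subset by auto
  moreover have "\<one>\<^bsub>A\<^esub> \<notin> {x \<in> carrier A. x \<otimes>\<^bsub>A\<^esub> f = \<zero>\<^bsub>A\<^esub>}" using f by simp
  ultimately have ker2: "{x \<in> carrier A. x \<otimes>\<^bsub>A\<^esub> f = \<zero>\<^bsub>A\<^esub>} = M"
    using M.I_maximal[of "{x \<in> carrier A. x \<otimes>\<^bsub>A\<^esub> f = \<zero>\<^bsub>A\<^esub>}"] A.one_closed by fast
  have "l1.kerT = M" "l2.kerT = M"
    using ker2 V.coset_eq_self_iff[OF Msub] M.a_subset
    by (auto simp: l1.ker_def l2.ker_def)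
  \<comment> \<open>Rank-nullity speaks of records restricted to the image, so both images must be
    identified explicitly.\<close>
  moreover have "(quot_module A M)\<lparr>carrier := l1.imT\<rparr> = quot_module A M" "l2.imT = PIdl\<^bsub>A\<^esub> f"
    unfolding l1.im_def l2.im_def
    by (auto simp: cgenideal_def quot_module_def A_RCOSETS_def' a_r_coset_def')
  ultimately show ?thesis
    using l1.rank_nullity[OF fin_dim] l2.rank_nullity[OF fin_dim] by simp
qed

end


section \<open>Polynomials and affine algebras\<close>

text \<open>The integers are not well-ordered, so \<open>LEAST\<close> needs a lower bound; shifting
  by it reduces the claim to natural numbers. The order, the regularity index and the separator
  degree are all such minima.\<close>

lemma Least_int:
  fixes P :: "int \<Rightarrow> bool"
  assumes "P a" "\<And>x. P x \<Longrightarrow> b \<le> x"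
  shows "P (LEAST x. P x)" and "P x \<Longrightarrow> (LEAST x. P x) \<le> x"
proof -
  define n where "n = (LEAST n::nat. P (b + int n))"
  have "P (b + int (nat (a - b)))" using assms by simp
  then have Pn: "P (b + int n)" unfolding n_def by (rule LeastI)
  have le: "b + int n \<le> x" if "P x" for x
  proof -
    have "P (b + int (nat (x - b)))" using assms(2)[OF that] that by simp
    then have "n \<le> nat (x - b)" unfolding n_def by (rule Least_le)
    then show ?thesis using assms(2)[OF that] by linarith
  qed
  have "(LEAST x. P x) = b + int n" using Pn le by (rule Least_equality)
  then show "P (LEAST x. P x)" "P x \<Longrightarrow> (LEAST x. P x) \<le> x" using Pn le by auto
qed

section \<open>The polynomial ring as an algebra, and its ideals\<close>

lemma poly_alg_sel [simp]:
  "carrier poly_alg = UNIV" "mult poly_alg = (*)" "one poly_alg = 1" "zero poly_alg = 0"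
  "add poly_alg = (+)" "smult poly_alg = (\<lambda>c f. Poly_Mapping.single 0 c * f)"
  by (simp_all add: poly_alg_def)

lemma field_algebra_poly_alg:
  "field_algebra (class_ring :: 'k::field ring) (poly_alg :: ('k, ('n::finite, 'k) mpoly) module)"
proof -
  have ab: "abelian_group (poly_alg :: ('k, ('n, 'k) mpoly) module)"
    by (rule abelian_groupI) (auto simp: algebra_simps intro: exI[of _ "- x" for x])
  have cr: "cring (poly_alg :: ('k, ('n, 'k) mpoly) module)"
    by (rule cringI[OF ab comm_monoidI]) (auto simp: algebra_simps)
  have "Module.module (class_ring :: 'k ring) (poly_alg :: ('k, ('n, 'k) mpoly) module)"
    by (rule moduleI[OF _ ab])
      (auto simp: class_cring.is_cring algebra_simps single_add mult_single[of 0 _ 0, simplified, symmetric] single_one)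
  then show ?thesis
    using class_field cr
    by (simp add: field_algebra_def field_algebra_axioms_def vectorspace_def algebra_simps)
qed

interpretation poly: field_algebra "class_ring :: 'k::field ring" "poly_alg :: ('k, ('n::finite, 'k) mpoly) module"
  by (rule field_algebra_poly_alg)

lemma poly_alg_a_inv [simp]: "\<ominus>\<^bsub>poly_alg\<^esub> f = - (f :: ('n::finite, 'k::field) mpoly)"
  using poly.A.minus_equality[of "- f" f] by simp

lemma poly_alg_a_minus [simp]: "f \<ominus>\<^bsub>poly_alg\<^esub> g = f - (g :: ('n::finite, 'k::field) mpoly)"
  by (simp add: a_minus_def)

lemma poly_alg_pow [simp]: "f [^]\<^bsub>poly_alg\<^esub> (n::nat) = (f :: ('n::finite, 'k::field) mpoly) ^ n"
  by (induction n) (simp_all add: mult.commute)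

lemma ideal_poly_alg_iff:
  "ideal X poly_alg \<longleftrightarrow>
    0 \<in> X \<and> (\<forall>f\<in>X. \<forall>g\<in>X. f + g \<in> X) \<and> (\<forall>f\<in>X. \<forall>p. p * f \<in> (X :: ('n::finite, 'k::field) mpoly set))"
proof
  assume "ideal X poly_alg"
  then interpret X: ideal X poly_alg .
  show "0 \<in> X \<and> (\<forall>f\<in>X. \<forall>g\<in>X. f + g \<in> X) \<and> (\<forall>f\<in>X. \<forall>p. p * f \<in> X)"
    using X.zero_closed X.a_closed X.I_l_closed by auto
next
  assume *: "0 \<in> X \<and> (\<forall>f\<in>X. \<forall>g\<in>X. f + g \<in> X) \<and> (\<forall>f\<in>X. \<forall>p. p * f \<in> X)"
  have neg: "- f \<in> X" if "f \<in> X" for f using *[THEN conjunct2, THEN conjunct2, rule_format, OF that, of "-1"] by simp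
  show "ideal X poly_alg"
  proof (rule idealI[OF poly.A.ring_axioms])
    show "subgroup X (add_monoid poly_alg)"
    proof (rule subgroup.intro)
      fix f assume "f \<in> X"
      then show "inv\<^bsub>add_monoid poly_alg\<^esub> f \<in> X"
        using neg by (simp only: poly_alg_a_inv[unfolded a_inv_def])
    qed (use * in auto)
  qed (use * in \<open>auto simp: mult.commute[of _ x for x]\<close>)
qed

lemma ideal_poly_algD:
  assumes "ideal X poly_alg"
  shows "0 \<in> X" "f \<in> X \<Longrightarrow> g \<in> X \<Longrightarrow> f + g \<in> X" "f \<in> X \<Longrightarrow> p * f \<in> X"
  using assms by (simp_all add: ideal_poly_alg_iff)

lemma ideal_poly_alg_INT:
  assumes "\<And>j. j \<in> A \<Longrightarrow> ideal (Q j) poly_alg"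
  shows "ideal (\<Inter>j\<in>A. Q j) poly_alg"
  using assms by (simp add: ideal_poly_alg_iff)

text \<open>For sums, each binomial term of \<open>(a + b) ^ (n + m)\<close> has exponent at least n
  in a or at least m in b. Primeness follows by applying the primary condition to the product of
  \<open>a ^ n\<close> and \<open>b ^ n\<close>.\<close>

lemma primary_ideal_imp_primeideal_radical:
  fixes J :: "('n::finite, 'k::field) mpoly set"
  assumes J: "primary_ideal J poly_alg"
  shows "primeideal (radical poly_alg J) poly_alg"
proof -
  have idl: "ideal J poly_alg" and ne: "J \<noteq> UNIV"
    and prim: "\<And>a b. a * b \<in> J \<Longrightarrow> a \<in> J \<or> b \<in> radical poly_alg J"
    using J by (auto simp: primary_ideal_def)
  note J' = idl[unfolded ideal_poly_alg_iff]
  have rad: "a \<in> radical poly_alg J \<longleftrightarrow> (\<exists>n. a ^ n \<in> J)" for a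
    by (auto simp: radical_def)
  have up: "a ^ n \<in> J" if "a ^ m \<in> J" "m \<le> n" for a m n
    using J' that by (metis le_add_diff_inverse2 power_add)
  have "ideal (radical poly_alg J) poly_alg"
    unfolding ideal_poly_alg_iff
  proof (intro conjI ballI allI)
    show "0 \<in> radical poly_alg J" using J' unfolding rad by (intro exI[of _ 1]) simp
  next
    fix a b assume "a \<in> radical poly_alg J" "b \<in> radical poly_alg J"
    then obtain n m where n: "a ^ n \<in> J" and m: "b ^ m \<in> J" unfolding rad by auto
    have "of_nat ((n + m) choose k) * a ^ k * b ^ (n + m - k) \<in> J" for k
    proof (cases "n \<le> k")
      case True
      then have "(of_nat ((n + m) choose k) * b ^ (n + m - k)) * a ^ k \<in> J" using J' up[OF n] by blast
      then show ?thesis by (simp add: ac_simps)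
    next
      case False
      then show ?thesis using J' up[OF m, of "n + m - k"] by auto
    qed
    moreover have "finite A \<Longrightarrow> (\<And>k. k \<in> A \<Longrightarrow> g k \<in> J) \<Longrightarrow> sum g A \<in> J" for g :: "nat \<Rightarrow> _" and A
      by (induction A rule: finite_induct) (use J' in auto)
    ultimately have "(a + b) ^ (n + m) \<in> J" unfolding binomial_ring by simp
    then show "a + b \<in> radical poly_alg J" unfolding rad by blast
  next
    fix a p assume "a \<in> radical poly_alg J"
    then obtain n where "a ^ n \<in> J" unfolding rad by auto
    then have "p ^ n * a ^ n \<in> J" using J' by blast
    then have "(p * a) ^ n \<in> J" by (simp add: power_mult_distrib)
    then show "p * a \<in> radical poly_alg J" unfolding rad by blast
  qed
  moreover have "1 \<notin> radical poly_alg J"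
  proof
    assume "1 \<in> radical poly_alg J"
    then have "1 \<in> J" unfolding rad by simp
    then have "p * 1 \<in> J" for p using J' by blast
    then show False using ne by auto
  qed
  moreover have "a \<in> radical poly_alg J \<or> b \<in> radical poly_alg J" if ab: "a * b \<in> radical poly_alg J" for a b
  proof -
    obtain n where "a ^ n * b ^ n \<in> J" using ab unfolding rad by (auto simp: power_mult_distrib)
    then have "a ^ n \<in> J \<or> b ^ n \<in> radical poly_alg J" by (rule prim)
    then show ?thesis unfolding rad by (auto simp flip: power_mult)
  qed
  ultimately show ?thesis
    by (intro primeidealI poly.A.is_cring) auto
qed

text \<open>A bound on every monomial treats the zero polynomial uniformly and reduces closure
  properties to inclusions of supports.\<close>

lemma poly_filt_iff:
  "f \<in> poly_filt i \<longleftrightarrow> (\<forall>t\<in>Poly_Mapping.keys f. int (\<Sum>v\<in>UNIV. Poly_Mapping.lookup t v) \<le> i)"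
proof (cases "f = 0")
  case False
  let ?S = "(\<lambda>t. \<Sum>v\<in>UNIV. Poly_Mapping.lookup t v) ` Poly_Mapping.keys f"
  have S: "finite ?S" "?S \<noteq> {}" using False by auto
  have "int (Max ?S) \<le> i \<longleftrightarrow> (\<forall>s\<in>?S. int s \<le> i)"
    using Max_in[OF S] Max_ge[OF S(1)] by (meson of_nat_mono order_trans)
  then show ?thesis using False by (auto simp: poly_filt_def total_deg_def)
qed (simp add: poly_filt_def)

lemma poly_filt_mono: "i \<le> j \<Longrightarrow> poly_filt i \<subseteq> poly_filt j"
  by (auto simp: poly_filt_def)

lemma poly_filt_add: "f \<in> poly_filt i \<Longrightarrow> g \<in> poly_filt i \<Longrightarrow> f + g \<in> poly_filt i"
  using Poly_Mapping.keys_add[of f g] unfolding poly_filt_iff by blast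

lemma poly_filt_smult: "f \<in> poly_filt i \<Longrightarrow> Poly_Mapping.single 0 c * f \<in> poly_filt i"
  using keys_mult[of "Poly_Mapping.single 0 c" f] unfolding poly_filt_iff
  by (fastforce split: if_splits)

section \<open>The residue class ring of a zero-dimensional ideal\<close>

locale affine_algebra =
  fixes I :: "('n::finite, 'k::field) mpoly set"
  assumes ideal_I: "ideal I poly_alg"
    and proper: "I \<noteq> UNIV"
    and fin_dim_quot: "vectorspace.fin_dim class_ring (aff_alg I)"
begin

lemma field_algebra_aff_alg: "field_algebra class_ring (aff_alg I)"
  unfolding aff_alg_def by (rule poly.quot_module_field_algebra[OF ideal_I])

sublocale R: fin_dim_algebra class_ring "aff_alg I"
  using field_algebra_aff_alg fin_dim_quot
  by (simp add: fin_dim_algebra_def fin_dim_algebra_axioms_def)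

abbreviation cl :: "('n, 'k) mpoly \<Rightarrow> ('n, 'k) mpoly set" where
  "cl f \<equiv> I +>\<^bsub>poly_alg\<^esub> f"

lemma carrier_aff_alg: "carrier (aff_alg I) = range cl"
  by (simp add: aff_alg_def)

lemma zero_aff_alg: "\<zero>\<^bsub>aff_alg I\<^esub> = I"
  by (simp add: aff_alg_def)

lemma cl_carrier [simp]: "cl f \<in> carrier (aff_alg I)"
  by (simp add: carrier_aff_alg)

lemma cl_add: "cl f \<oplus>\<^bsub>aff_alg I\<^esub> cl g = cl (f + g)"
  using poly.V.quot_module_add[OF poly.ideal_submodule[OF ideal_I], of f g] by (simp add: aff_alg_def)

lemma cl_mult: "cl f \<otimes>\<^bsub>aff_alg I\<^esub> cl g = cl (f * g)"
  using poly.quot_module_mult[OF ideal_I, of f g] by (simp add: aff_alg_def)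

lemma cl_smult: "c \<odot>\<^bsub>aff_alg I\<^esub> cl f = cl (Poly_Mapping.single 0 c * f)"
  using poly.V.quot_module_smult[OF poly.ideal_submodule[OF ideal_I], of c f] by (simp add: aff_alg_def)

lemma cl_one: "\<one>\<^bsub>aff_alg I\<^esub> = cl 1"
  by (simp add: aff_alg_def quot_module_one)

lemma cl_pow: "cl f [^]\<^bsub>aff_alg I\<^esub> (n::nat) = cl (f ^ n)"
  by (induction n) (simp_all add: cl_one cl_mult mult.commute)

lemma cl_eq_iff: "cl f = cl g \<longleftrightarrow> f - g \<in> I"
  using poly.V.coset_eq_iff[OF poly.ideal_submodule[OF ideal_I], of f g] by simp

lemma cl_eq_zero_iff: "cl f = \<zero>\<^bsub>aff_alg I\<^esub> \<longleftrightarrow> f \<in> I"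
  using poly.V.coset_eq_self_iff[OF poly.ideal_submodule[OF ideal_I], of f] by (simp add: zero_aff_alg)

lemma one_notin_I: "1 \<notin> I"
  using ideal.one_imp_carrier[OF ideal_I] proper by auto

lemma ring_hom_cl: "ring_hom_ring poly_alg (aff_alg I) cl"
  using poly.quot_module_ring_hom[OF ideal_I] poly.A.ring_axioms R.A.ring_axioms
  by (simp add: aff_alg_def ring_hom_ring_def ring_hom_ring_axioms_def ring_hom_cring_def ring_hom_cring_axioms_def)

lemma cl_in_img_iff:
  assumes "ideal X poly_alg" "I \<subseteq> X"
  shows "cl f \<in> img I X \<longleftrightarrow> f \<in> X"
proof
  assume "cl f \<in> img I X"
  then obtain g where g: "g \<in> X" "f - g \<in> I" by (auto simp: img_def cl_eq_iff)
  then have "(f - g) + g \<in> X" using assms unfolding ideal_poly_alg_iff by blast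
  then show "f \<in> X" by simp
qed (simp add: img_def)

lemma img_subset: "img I X \<subseteq> carrier (aff_alg I)"
  by (auto simp: img_def)

lemma ideal_img:
  assumes "ideal X poly_alg"
  shows "ideal (img I X) (aff_alg I)"
proof (rule idealI[OF R.A.ring_axioms])
  interpret X: ideal X poly_alg by fact
  show "subgroup (img I X) (add_monoid (aff_alg I))"
    unfolding img_def by (rule ring_hom_ring.img_is_add_subgroup[OF ring_hom_cl X.a_subgroup])
next
  fix a x assume "a \<in> img I X" "x \<in> carrier (aff_alg I)"
  then obtain f g where "f \<in> X" "a = cl f" "x = cl g" by (auto simp: img_def carrier_aff_alg)
  then show "x \<otimes>\<^bsub>aff_alg I\<^esub> a \<in> img I X" "a \<otimes>\<^bsub>aff_alg I\<^esub> x \<in> img I X"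
    using assms unfolding ideal_poly_alg_iff by (auto simp: img_def cl_mult mult.commute[of f])
qed

lemma primeideal_img:
  assumes "primeideal X poly_alg" "I \<subseteq> X"
  shows "primeideal (img I X) (aff_alg I)"
proof -
  interpret X: primeideal X poly_alg by fact
  note mem = cl_in_img_iff[OF X.ideal_axioms assms(2)]
  show ?thesis
  proof (rule primeidealI[OF ideal_img[OF X.ideal_axioms] R.A.is_cring])
    show "carrier (aff_alg I) \<noteq> img I X"
      using X.I_notcarr mem cl_carrier by (metis UNIV_eq_I poly_alg_sel(1))
    fix a b assume "a \<in> carrier (aff_alg I)" "b \<in> carrier (aff_alg I)" "a \<otimes>\<^bsub>aff_alg I\<^esub> b \<in> img I X"
    then obtain f g where "a = cl f" "b = cl g" "f * g \<in> X" by (auto simp: carrier_aff_alg cl_mult mem)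
    then show "a \<in> img I X \<or> b \<in> img I X" using X.I_prime[of f g] by (auto simp: mem)
  qed
qed

section \<open>The induced filtration: regularity index, orders and leading forms\<close>

lemma submodule_deg_filt: "submodule class_ring (deg_filt I i) (aff_alg I)"
proof (rule submodule.intro)
  show "\<zero>\<^bsub>aff_alg I\<^esub> \<in> deg_filt I i"
    unfolding deg_filt_def img_def
    using cl_eq_zero_iff[of 0] ideal_I[unfolded ideal_poly_alg_iff] by (auto simp: poly_filt_def intro!: image_eqI[of _ _ 0])
qed (auto simp: R.V.module_axioms deg_filt_def img_def cl_add cl_smult poly_filt_add poly_filt_smult)

lemma deg_filt_mono: "i \<le> j \<Longrightarrow> deg_filt I i \<subseteq> deg_filt I j"
  unfolding deg_filt_def img_def using poly_filt_mono by blast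

text \<open>Total degrees are natural numbers. All the integer minima below owe their lower bound 0
  to this fact.\<close>

lemma deg_filt_neg: "i < 0 \<Longrightarrow> deg_filt I i = {\<zero>\<^bsub>aff_alg I\<^esub>}"
  using cl_eq_zero_iff[of 0] ideal_I[unfolded ideal_poly_alg_iff]
  by (auto simp: deg_filt_def img_def poly_filt_def)

lemma deg_filt_subset: "deg_filt I i \<subseteq> carrier (aff_alg I)"
  by (auto simp: deg_filt_def img_def)

text \<open>In the zero ring every filtration step is the whole ring and the regularity index would
  have no least candidate; properness of \<open>I\<close> excludes this.\<close>

lemma zero_neq_carrier: "carrier (aff_alg I) \<noteq> {\<zero>\<^bsub>aff_alg I\<^esub>}"
  using cl_eq_zero_iff[of 1] one_notin_I cl_carrier by blast

lemma ex_deg_filt: assumes "x \<in> carrier (aff_alg I)" shows "\<exists>i. x \<in> deg_filt I i"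
proof -
  obtain f where "x = cl f" using assms by (auto simp: carrier_aff_alg)
  then show ?thesis by (auto simp: deg_filt_def img_def poly_filt_def intro!: exI[of _ "int (total_deg f)"])
qed

text \<open>The filtration is exhaustive and increasing, so one step contains a whole finite
  generating set, and with it its span.\<close>

lemma ex_deg_filt_eq_carrier: "\<exists>i. deg_filt I i = carrier (aff_alg I)"
proof -
  obtain B where B: "finite B" "B \<subseteq> carrier (aff_alg I)" "R.V.gen_set B"
    using R.fin_dim by (auto simp: R.V.fin_dim_def)
  have "\<exists>i. B \<subseteq> deg_filt I i"
    using B(1,2)
  proof (induction B rule: finite_induct)
    case (insert b B)
    then obtain i j where "B \<subseteq> deg_filt I i" "b \<in> deg_filt I j" using ex_deg_filt[of b] by auto
    then have "insert b B \<subseteq> deg_filt I (max i j)"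
      using deg_filt_mono[of i "max i j"] deg_filt_mono[of j "max i j"] by auto
    then show ?case by blast
  qed simp
  then obtain i where "B \<subseteq> deg_filt I i" by blast
  then have "R.V.span B \<subseteq> deg_filt I i" by (intro R.V.span_is_subset submodule_deg_filt)
  then show ?thesis using B(3) deg_filt_subset by blast
qed

text \<open>A subspace of full dimension is everything, and monotonicity then makes the condition on
  all later indices automatic.\<close>

lemma reg_index_eq: "reg_index I = (LEAST i. deg_filt I i = carrier (aff_alg I))"
proof -
  have eq: "aff_HF I i = vectorspace.dim class_ring (aff_alg I) \<longleftrightarrow> deg_filt I i = carrier (aff_alg I)" for i
    using R.V.submodule_dim(3)[OF R.fin_dim submodule_deg_filt[of i]] by (auto simp: aff_HF_def)
  have "(\<forall>j\<ge>i. deg_filt I j = carrier (aff_alg I)) \<longleftrightarrow> deg_filt I i = carrier (aff_alg I)" for i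
    using deg_filt_mono deg_filt_subset by blast
  then show ?thesis unfolding reg_index_def eq by simp
qed

lemma deg_filt_eq_carrier_imp_nonneg: "deg_filt I i = carrier (aff_alg I) \<Longrightarrow> 0 \<le> i"
  using deg_filt_neg[of i] zero_neq_carrier by (cases "i < 0") auto

lemma deg_filt_reg_index: "deg_filt I (reg_index I) = carrier (aff_alg I)"
proof -
  obtain i where "deg_filt I i = carrier (aff_alg I)" using ex_deg_filt_eq_carrier by blast
  then show ?thesis
    unfolding reg_index_eq
    by (rule Least_int(1)[of "\<lambda>i. deg_filt I i = carrier (aff_alg I)" i 0])
      (rule deg_filt_eq_carrier_imp_nonneg)
qed

lemma filt_ord_le_iff:
  assumes "x \<in> carrier (aff_alg I)" "x \<noteq> \<zero>\<^bsub>aff_alg I\<^esub>"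
  shows "filt_ord I x \<le> d \<longleftrightarrow> x \<in> deg_filt I d"
proof -
  have nonneg: "0 \<le> i" if "x \<in> deg_filt I i" for i
    using that deg_filt_neg[of i] assms(2) by (cases "i < 0") auto
  obtain a where a: "x \<in> deg_filt I a" using ex_deg_filt[OF assms(1)] by blast
  show ?thesis
    using Least_int[of "\<lambda>i. x \<in> deg_filt I i" a 0, OF a nonneg] deg_filt_mono[of "filt_ord I x" d]
    unfolding filt_ord_def by blast
qed

lemma filt_ord_bounds:
  assumes "x \<in> carrier (aff_alg I)" "x \<noteq> \<zero>\<^bsub>aff_alg I\<^esub>"
  shows "filt_ord I x \<in> {0..reg_index I}"
  using filt_ord_le_iff[OF assms, of "-1"] filt_ord_le_iff[OF assms, of "reg_index I"]
    deg_filt_neg[of "-1"] assms deg_filt_reg_index by auto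

lemma gr_part_reg_index: "gr_part I (reg_index I) = quot_module (aff_alg I) (deg_filt I (reg_index I - 1))"
  unfolding gr_part_def deg_filt_reg_index by simp

text \<open>Both branches of the case distinction are one coset map: order below
  \<open>reg_index I\<close> means membership in the preceding step, whose coset is the zero class.
  Hence \<open>top_form\<close> is K-linear.\<close>

lemma top_form_eq:
  assumes "x \<in> carrier (aff_alg I)"
  shows "top_form I x = deg_filt I (reg_index I - 1) +>\<^bsub>aff_alg I\<^esub> x"
proof (cases "x \<noteq> \<zero>\<^bsub>aff_alg I\<^esub> \<and> filt_ord I x = reg_index I")
  case True
  then show ?thesis by (simp add: top_form_def lead_form_def)
next
  case False
  have "x \<in> deg_filt I (reg_index I - 1)"
  proof (cases "x = \<zero>\<^bsub>aff_alg I\<^esub>")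
    case True
    then show ?thesis using submodule.zero_closed[OF submodule_deg_filt] by simp
  next
    case nz: False
    then show ?thesis using False filt_ord_bounds[OF assms nz] filt_ord_le_iff[OF assms nz, of "reg_index I - 1"] by auto
  qed
  then have "deg_filt I (reg_index I - 1) +>\<^bsub>aff_alg I\<^esub> x = deg_filt I (reg_index I - 1)"
    using R.V.coset_eq_self_iff[OF submodule_deg_filt assms] by simp
  then show ?thesis using False by (auto simp: top_form_def gr_part_reg_index)
qed

text \<open>Although \<open>J\<close> may be infinite, its orders lie in a finite integer interval,
  so \<open>Max\<close> is attained. That maximum falls below \<open>reg_index I\<close> exactly
  when all of \<open>J\<close> lies in the preceding filtration step.\<close>

lemma ri_ideal_props:
  assumes "J \<subseteq> carrier (aff_alg I)" "J \<noteq> {\<zero>\<^bsub>aff_alg I\<^esub>}" "J \<noteq> {}"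
  shows "ri_ideal I J \<in> {0..reg_index I}"
    and "ri_ideal I J = reg_index I \<longleftrightarrow> \<not> J \<subseteq> deg_filt I (reg_index I - 1)"
proof -
  let ?O = "filt_ord I ` (J - {\<zero>\<^bsub>aff_alg I\<^esub>})"
  have sub: "?O \<subseteq> {0..reg_index I}" using filt_ord_bounds assms(1) by blast
  then have fin: "finite ?O" by (rule finite_subset) simp
  have ne: "?O \<noteq> {}" using assms by auto
  have M: "Max ?O \<in> ?O" using Max_in[OF fin ne] .
  then show "ri_ideal I J \<in> {0..reg_index I}" using sub unfolding ri_ideal_def by blast
  have zero: "\<zero>\<^bsub>aff_alg I\<^esub> \<in> deg_filt I (reg_index I - 1)"
    using submodule.zero_closed[OF submodule_deg_filt] .
  have "Max ?O = reg_index I \<longleftrightarrow> \<not> Max ?O \<le> reg_index I - 1"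
    using M sub by fastforce
  also have "\<dots> \<longleftrightarrow> \<not> (\<forall>x\<in>J - {\<zero>\<^bsub>aff_alg I\<^esub>}. x \<in> deg_filt I (reg_index I - 1))"
    using assms(1) filt_ord_le_iff[of _ "reg_index I - 1"] by (subst Max_le_iff[OF fin ne]) auto
  also have "\<dots> \<longleftrightarrow> \<not> J \<subseteq> deg_filt I (reg_index I - 1)" using zero by blast
  finally show "ri_ideal I J = reg_index I \<longleftrightarrow> \<not> J \<subseteq> deg_filt I (reg_index I - 1)"
    unfolding ri_ideal_def .
qed

end


section \<open>Socle spaces and minimal divisors\<close>

locale primary_component = affine_algebra I
  for I :: "('n::finite, 'k::field) mpoly set" +
  fixes Q :: "nat \<Rightarrow> ('n, 'k) mpoly set" and s i :: nat
  assumes decomposition: "primary_decomposition poly_alg I s Q"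
    and i: "i \<in> {1..s}"
begin

abbreviation rest :: "('n, 'k) mpoly set" where
  "rest \<equiv> \<Inter>j\<in>{1..s} - {i}. Q j"

abbreviation socle :: "('n, 'k) mpoly set set" where
  "socle \<equiv> socle_space I s Q i"

lemma ideal_Q: "j \<in> {1..s} \<Longrightarrow> ideal (Q j) poly_alg"
  using decomposition by (auto simp: primary_decomposition_def primary_ideal_def)

lemma INT_fun_upd: "(\<Inter>j\<in>{1..s}. (Q(i := Q')) j) = Q' \<inter> rest"
  using i by (auto split: if_splits)

lemma I_eq: "I = Q i \<inter> rest"
  using decomposition INT_fun_upd[of "Q i"] by (simp add: primary_decomposition_def)

lemma I_subset_Q: "j \<in> {1..s} \<Longrightarrow> I \<subseteq> Q j"
  using I_eq by (cases "j = i") auto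

lemma ideal_rest: "ideal rest poly_alg"
  by (rule ideal_poly_alg_INT) (use ideal_Q in auto)

lemma rest_neq: "rest \<noteq> I"
  using decomposition i by (auto simp: primary_decomposition_def)

lemma Q_subset_radical: "Q i \<subseteq> radical poly_alg (Q i)"
  by (auto simp: radical_def intro: exI[of _ 1])

lemma maximalideal_max_id: "maximalideal (max_id I Q i) (aff_alg I)"
proof -
  have "primeideal (radical poly_alg (Q i)) poly_alg"
    using decomposition i by (intro primary_ideal_imp_primeideal_radical) (auto simp: primary_decomposition_def)
  then show ?thesis
    unfolding max_id_def using I_subset_Q[OF i] Q_subset_radical
    by (intro R.primeideal_imp_maximalideal primeideal_img) auto
qed

lemma max_id_subset: "max_id I Q i \<subseteq> carrier (aff_alg I)"
  unfolding max_id_def by (rule img_subset)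

lemma max_id_nilpotent:
  assumes "y \<in> max_id I Q i"
  shows "\<exists>n::nat. y [^]\<^bsub>aff_alg I\<^esub> n \<in> img I (Q i)"
proof -
  obtain f n where "y = cl f" "f ^ n \<in> Q i"
    using assms by (auto simp: max_id_def radical_def img_def)
  then show ?thesis by (intro exI[of _ n]) (simp add: img_def cl_pow)
qed

text \<open>Representatives multiply into both \<open>Q i\<close> and \<open>rest\<close>, whose
  intersection is \<open>I\<close>.\<close>

lemma img_Q_rest_zero:
  assumes "x \<in> img I (Q i)" "w \<in> img I rest"
  shows "x \<otimes>\<^bsub>aff_alg I\<^esub> w = \<zero>\<^bsub>aff_alg I\<^esub>"
proof -
  obtain f g where fg: "f \<in> Q i" "g \<in> rest" "x = cl f" "w = cl g" using assms unfolding img_def by blast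
  have "g * f \<in> Q i" "f * g \<in> rest"
    using ideal_poly_algD(3)[OF ideal_Q[OF i] fg(1)] ideal_poly_algD(3)[OF ideal_rest fg(2)] by auto
  then have "f * g \<in> I" using I_eq by (simp add: mult.commute)
  then show ?thesis using fg by (simp add: cl_mult cl_eq_zero_iff)
qed

lemma loc_factor_zero: "\<zero>\<^bsub>loc_factor I Q j\<^esub> = img I (Q j)"
  by (simp add: loc_factor_def)

text \<open>Vanishing of all other Chinese Remainder coordinates means lying in \<open>rest\<close>.
  On \<open>rest\<close>, being zero modulo \<open>Q i\<close> is the same as being zero modulo
  \<open>I\<close>, so the local socle condition becomes annihilation by \<open>max_id I Q i\<close>
  in R itself.\<close>

lemma socle_space_eq:
  "socle = img I rest \<inter> {x \<in> carrier (aff_alg I). \<forall>y\<in>max_id I Q i. y \<otimes>\<^bsub>aff_alg I\<^esub> x = \<zero>\<^bsub>aff_alg I\<^esub>}"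
proof -
  have "cl f \<in> socle \<longleftrightarrow> cl f \<in> img I rest \<and> (\<forall>y\<in>max_id I Q i. y \<otimes>\<^bsub>aff_alg I\<^esub> cl f = \<zero>\<^bsub>aff_alg I\<^esub>)" for f
  proof -
    have coset: "img I (Q j) +>\<^bsub>aff_alg I\<^esub> cl f = img I (Q j) \<longleftrightarrow> f \<in> Q j" if "j \<in> {1..s}" for j
      using R.V.coset_eq_self_iff[OF R.ideal_submodule[OF ideal_img[OF ideal_Q[OF that]]], of "cl f"]
        cl_in_img_iff[OF ideal_Q I_subset_Q] that by simp
    have loc: "img I (Q i) +>\<^bsub>aff_alg I\<^esub> cl f \<in> local_socle (loc_factor I Q i) \<longleftrightarrow>
        (\<forall>y\<in>max_id I Q i. y \<otimes>\<^bsub>aff_alg I\<^esub> cl f \<in> img I (Q i))"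
      unfolding loc_factor_def
      using Q_subset_radical max_id_nilpotent
      by (intro R.local_socle_quot_module_iff ideal_img ideal_Q i maximalideal_max_id)
        (auto simp: max_id_def img_def)
    have "cl f \<in> socle \<longleftrightarrow> (\<forall>j\<in>{1..s}. img I (Q j) +>\<^bsub>aff_alg I\<^esub> cl f \<in>
        (if j = i then local_socle (loc_factor I Q i) else {img I (Q j)}))"
      unfolding socle_space_def crt_map_def loc_factor_zero by (auto simp: PiE_iff)
    also have "\<dots> \<longleftrightarrow> f \<in> rest \<and> (\<forall>y\<in>max_id I Q i. y \<otimes>\<^bsub>aff_alg I\<^esub> cl f \<in> img I (Q i))"
      using coset loc i by (auto split: if_splits)
    also have "\<dots> \<longleftrightarrow> f \<in> rest \<and> (\<forall>y\<in>max_id I Q i. y \<otimes>\<^bsub>aff_alg I\<^esub> cl f = \<zero>\<^bsub>aff_alg I\<^esub>)"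
    proof (intro conj_cong ball_cong refl)
      fix y assume f: "f \<in> rest" and "y \<in> max_id I Q i"
      then obtain g where y: "y = cl g" by (auto simp: max_id_def img_def)
      have "g * f \<in> rest" by (rule ideal_poly_algD(3)[OF ideal_rest f])
      then have "g * f \<in> Q i \<longleftrightarrow> g * f \<in> I" using I_eq by auto
      then show "y \<otimes>\<^bsub>aff_alg I\<^esub> cl f \<in> img I (Q i) \<longleftrightarrow> y \<otimes>\<^bsub>aff_alg I\<^esub> cl f = \<zero>\<^bsub>aff_alg I\<^esub>"
        using cl_in_img_iff[OF ideal_Q[OF i] I_subset_Q[OF i]] by (simp add: y cl_mult cl_eq_zero_iff)
    qed
    also have "f \<in> rest \<longleftrightarrow> cl f \<in> img I rest"
      using cl_in_img_iff[OF ideal_rest] I_eq by blast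
    finally show ?thesis .
  qed
  moreover have "socle \<subseteq> carrier (aff_alg I)" by (auto simp: socle_space_def)
  ultimately show ?thesis by (auto simp: carrier_aff_alg)
qed

lemma ideal_socle: "ideal socle (aff_alg I)"
  unfolding socle_space_eq
  by (intro R.A.i_intersect ideal_img ideal_rest R.ideal_annihilator max_id_subset)

lemma max_id_socle: "y \<in> max_id I Q i \<Longrightarrow> x \<in> socle \<Longrightarrow> y \<otimes>\<^bsub>aff_alg I\<^esub> x = \<zero>\<^bsub>aff_alg I\<^esub>"
  using socle_space_eq by blast

lemma socle_carrier: "x \<in> socle \<Longrightarrow> x \<in> carrier (aff_alg I)"
  using socle_space_eq by blast

section \<open>Minimal divisors as principal ideals generated by socle elements\<close>

lemma dim_cgenideal_socle:
  assumes "g \<in> socle" "g \<noteq> \<zero>\<^bsub>aff_alg I\<^esub>"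
  shows "vectorspace.dim class_ring ((aff_alg I)\<lparr>carrier := PIdl\<^bsub>aff_alg I\<^esub> g\<rparr>) = res_deg I Q i"
  unfolding res_deg_def res_field_def
  using assms max_id_socle socle_carrier by (intro R.dim_cgenideal maximalideal_max_id)

lemma ex_socle_element_of_ideal:
  assumes J: "ideal J (aff_alg I)" "J \<noteq> {\<zero>\<^bsub>aff_alg I\<^esub>}" "J \<subseteq> img I rest"
  obtains g where "g \<in> J" "g \<in> socle" "g \<noteq> \<zero>\<^bsub>aff_alg I\<^esub>"
proof -
  obtain g where g: "g \<in> J" "g \<noteq> \<zero>\<^bsub>aff_alg I\<^esub>"
    "\<And>y. y \<in> max_id I Q i \<Longrightarrow> y \<otimes>\<^bsub>aff_alg I\<^esub> g = \<zero>\<^bsub>aff_alg I\<^esub>"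
  proof (rule R.ex_socle_element[OF J(1,2) max_id_subset])
    fix y assume "y \<in> max_id I Q i"
    then show "\<exists>n::nat. \<forall>w\<in>J. y [^]\<^bsub>aff_alg I\<^esub> n \<otimes>\<^bsub>aff_alg I\<^esub> w = \<zero>\<^bsub>aff_alg I\<^esub>"
      using max_id_nilpotent img_Q_rest_zero J(3) by blast
  qed blast
  then have "g \<in> socle" using J(3) img_subset[of rest] unfolding socle_space_eq by blast
  then show thesis using that g by blast
qed

text \<open>Irredundancy of the decomposition makes the image of \<open>rest\<close> a nonzero
  ideal, in which a socle element can be found.\<close>

lemma ex_socle_nonzero: obtains g where "g \<in> socle" "g \<noteq> \<zero>\<^bsub>aff_alg I\<^esub>"
proof -
  obtain f where "f \<in> rest" "f \<notin> I" using rest_neq I_eq by blast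
  then have "cl f \<in> img I rest" "cl f \<noteq> \<zero>\<^bsub>aff_alg I\<^esub>" by (auto simp: img_def cl_eq_zero_iff)
  then have "img I rest \<noteq> {\<zero>\<^bsub>aff_alg I\<^esub>}" by blast
  then show thesis using ex_socle_element_of_ideal[OF ideal_img[OF ideal_rest]] that by blast
qed

lemma min_divisor_imp_cgenideal:
  assumes J: "is_min_divisor I s Q i J"
  obtains g where "g \<in> socle" "g \<noteq> \<zero>\<^bsub>aff_alg I\<^esub>" "img I J = PIdl\<^bsub>aff_alg I\<^esub> g"
proof -
  obtain Q' where Q': "ideal Q' poly_alg" "Q i \<subset> Q'" "J = Q' \<inter> rest"
    using J unfolding is_min_divisor_def is_divisor_def INT_fun_upd by blast
  have dim: "vectorspace.dim class_ring ((aff_alg I)\<lparr>carrier := img I J\<rparr>) = res_deg I Q i"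
    using J by (simp add: is_min_divisor_def)
  have "ideal J poly_alg" using poly.A.i_intersect[OF Q'(1) ideal_rest] Q'(3) by simp
  then have iJ: "ideal (img I J) (aff_alg I)" by (rule ideal_img)
  have max: "PIdl\<^bsub>aff_alg I\<^esub> g = img I J" if "g \<in> socle" "g \<noteq> \<zero>\<^bsub>aff_alg I\<^esub>" "PIdl\<^bsub>aff_alg I\<^esub> g \<subseteq> img I J" for g
    using that dim dim_cgenideal_socle[OF that(1,2)] socle_carrier[OF that(1)]
    by (intro R.submodule_dim_eq R.ideal_submodule iJ R.A.cgenideal_ideal) auto
  \<comment> \<open>The dimension decides this: a zero image would be contained in some nonzero
    principal ideal generated by a socle element and have the same dimension, forcing that ideal to
    vanish.\<close>
  have "img I J \<noteq> {\<zero>\<^bsub>aff_alg I\<^esub>}"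
  proof
    assume *: "img I J = {\<zero>\<^bsub>aff_alg I\<^esub>}"
    obtain g where g: "g \<in> socle" "g \<noteq> \<zero>\<^bsub>aff_alg I\<^esub>" by (rule ex_socle_nonzero)
    have iP: "ideal (PIdl\<^bsub>aff_alg I\<^esub> g) (aff_alg I)" using R.A.cgenideal_ideal[OF socle_carrier[OF g(1)]] .
    have "\<zero>\<^bsub>aff_alg I\<^esub> \<in> PIdl\<^bsub>aff_alg I\<^esub> g"
      using iP by (simp add: additive_subgroup.zero_closed ideal.axioms(1))
    then have "img I J = PIdl\<^bsub>aff_alg I\<^esub> g"
      using dim dim_cgenideal_socle[OF g] * iP
      by (intro R.submodule_dim_eq R.ideal_submodule iJ) auto
    then show False using * R.A.cgenideal_self[OF socle_carrier[OF g(1)]] g(2) by auto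
  qed
  moreover have "img I J \<subseteq> img I rest" using Q'(3) by (auto simp: img_def)
  ultimately obtain g where g: "g \<in> img I J" "g \<in> socle" "g \<noteq> \<zero>\<^bsub>aff_alg I\<^esub>"
    using ex_socle_element_of_ideal[OF iJ] by blast
  then show thesis using that max R.A.cgenideal_minimal[OF iJ g(1)] by metis
qed

lemma ex_min_divisor:
  assumes g: "g \<in> socle" "g \<noteq> \<zero>\<^bsub>aff_alg I\<^esub>"
  obtains J where "is_min_divisor I s Q i J" "img I J = PIdl\<^bsub>aff_alg I\<^esub> g"
proof -
  obtain f where f: "g = cl f" "f \<in> rest"
    using g(1) unfolding socle_space_eq img_def by blast
  have "f \<notin> I" using g(2) by (simp add: f(1) cl_eq_zero_iff)
  then have fQ: "f \<notin> Q i" using f(2) I_eq by blast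
  note idQ = ideal_poly_algD[OF ideal_Q[OF i]] and idr = ideal_poly_algD[OF ideal_rest]
  \<comment> \<open>Since \<open>f\<close> lies in the intersection of the other components, the modular law shows that
    replacing \<open>Q i\<close> by \<open>Q i + (f)\<close> enlarges \<open>I\<close> exactly to \<open>I + (f)\<close>.\<close>
  define Q' where "Q' = {q + p * f | q p. q \<in> Q i}"
  have Q'I: "q + p * f \<in> Q'" if "q \<in> Q i" for q p using that by (auto simp: Q'_def)
  have id: "ideal Q' poly_alg"
    unfolding ideal_poly_alg_iff
  proof (intro conjI ballI allI)
    show "0 \<in> Q'" using Q'I[of 0 0] idQ(1) by simp
  next
    fix a b assume "a \<in> Q'" "b \<in> Q'"
    then obtain q p q' p' where "q \<in> Q i" "q' \<in> Q i" "a = q + p * f" "b = q' + p' * f" by (auto simp: Q'_def)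
    then show "a + b \<in> Q'" using Q'I[of "q + q'" "p + p'"] idQ(2) by (simp add: algebra_simps)
  next
    fix a c assume "a \<in> Q'"
    then obtain q p where "q \<in> Q i" "a = q + p * f" by (auto simp: Q'_def)
    then show "c * a \<in> Q'" using Q'I[of "c * q" "c * p"] idQ(3) by (simp add: algebra_simps)
  qed
  have "Q i \<subseteq> Q'" using Q'I[of _ 0] by auto
  moreover have "f \<in> Q'" using Q'I[of 0 1] idQ(1) by simp
  ultimately have div: "is_divisor I s Q i (Q' \<inter> rest)"
    unfolding is_divisor_def INT_fun_upd using id fQ by blast
  have img: "img I (Q' \<inter> rest) = PIdl\<^bsub>aff_alg I\<^esub> g"
  proof (intro equalityI subsetI)
    fix x assume "x \<in> img I (Q' \<inter> rest)"
    then obtain h where h: "h \<in> Q'" "h \<in> rest" "x = cl h" unfolding img_def by blast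
    then obtain q p where q: "q \<in> Q i" "h = q + p * f" by (auto simp: Q'_def)
    \<comment> \<open>This difference is q, which therefore lies in \<open>Q i\<close> and in
      \<open>rest\<close>, that is, in \<open>I\<close>; so h and \<open>p * f\<close> have the same
      class.\<close>
    have "h + (- p) * f \<in> rest" by (rule idr(2)[OF h(2) idr(3)[OF f(2)]])
    then have "q \<in> I" using q I_eq by simp
    then have "x = cl p \<otimes>\<^bsub>aff_alg I\<^esub> g" using h q f by (simp add: cl_mult cl_eq_iff)
    then show "x \<in> PIdl\<^bsub>aff_alg I\<^esub> g" unfolding cgenideal_def using cl_carrier by blast
  next
    fix x assume "x \<in> PIdl\<^bsub>aff_alg I\<^esub> g"
    then obtain p where "x = cl (p * f)" by (auto simp: cgenideal_def carrier_aff_alg f cl_mult)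
    moreover have "p * f \<in> Q'" using Q'I[of 0 p] idQ(1) by simp
    moreover have "p * f \<in> rest" by (rule idr(3)[OF f(2)])
    ultimately show "x \<in> img I (Q' \<inter> rest)" unfolding img_def by blast
  qed
  show thesis
    using that[of "Q' \<inter> rest"] div img dim_cgenideal_socle[OF g] by (simp add: is_min_divisor_def)
qed

text \<open>The separator degree is the minimum of a nonempty set of values in
  \<open>{0..reg_index I}\<close>. Such a minimum equals the upper end only if every value
  does.\<close>

lemma sepdeg_eq_reg_index_iff:
  "sepdeg I s Q i = reg_index I \<longleftrightarrow>
    (\<forall>g\<in>socle. g \<noteq> \<zero>\<^bsub>aff_alg I\<^esub> \<longrightarrow> \<not> PIdl\<^bsub>aff_alg I\<^esub> g \<subseteq> deg_filt I (reg_index I - 1))"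
proof -
  let ?D = "\<lambda>d. \<exists>J. is_min_divisor I s Q i J \<and> d = ri_ideal I (img I J)"
  have D: "?D d \<longleftrightarrow> (\<exists>g\<in>socle. g \<noteq> \<zero>\<^bsub>aff_alg I\<^esub> \<and> d = ri_ideal I (PIdl\<^bsub>aff_alg I\<^esub> g))" for d
  proof
    assume "?D d"
    then obtain J where J: "is_min_divisor I s Q i J" "d = ri_ideal I (img I J)" by blast
    obtain g where "g \<in> socle" "g \<noteq> \<zero>\<^bsub>aff_alg I\<^esub>" "img I J = PIdl\<^bsub>aff_alg I\<^esub> g"
      using min_divisor_imp_cgenideal[OF J(1)] .
    then show "\<exists>g\<in>socle. g \<noteq> \<zero>\<^bsub>aff_alg I\<^esub> \<and> d = ri_ideal I (PIdl\<^bsub>aff_alg I\<^esub> g)" using J(2) by auto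
  next
    assume "\<exists>g\<in>socle. g \<noteq> \<zero>\<^bsub>aff_alg I\<^esub> \<and> d = ri_ideal I (PIdl\<^bsub>aff_alg I\<^esub> g)"
    then obtain g where g: "g \<in> socle" "g \<noteq> \<zero>\<^bsub>aff_alg I\<^esub>" "d = ri_ideal I (PIdl\<^bsub>aff_alg I\<^esub> g)" by blast
    obtain J where "is_min_divisor I s Q i J" "img I J = PIdl\<^bsub>aff_alg I\<^esub> g" using ex_min_divisor[OF g(1,2)] .
    then show "?D d" using g(3) by auto
  qed
  have ri: "ri_ideal I (PIdl\<^bsub>aff_alg I\<^esub> g) \<in> {0..reg_index I}"
    "ri_ideal I (PIdl\<^bsub>aff_alg I\<^esub> g) = reg_index I \<longleftrightarrow> \<not> PIdl\<^bsub>aff_alg I\<^esub> g \<subseteq> deg_filt I (reg_index I - 1)"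
    if g: "g \<in> socle" "g \<noteq> \<zero>\<^bsub>aff_alg I\<^esub>" for g
  proof -
    have gP: "g \<in> PIdl\<^bsub>aff_alg I\<^esub> g" using R.A.cgenideal_self[OF socle_carrier[OF g(1)]] .
    have "PIdl\<^bsub>aff_alg I\<^esub> g \<subseteq> carrier (aff_alg I)"
      using ideal.axioms(1)[OF R.A.cgenideal_ideal[OF socle_carrier[OF g(1)]]] additive_subgroup.a_subset by blast
    then show "ri_ideal I (PIdl\<^bsub>aff_alg I\<^esub> g) \<in> {0..reg_index I}"
      "ri_ideal I (PIdl\<^bsub>aff_alg I\<^esub> g) = reg_index I \<longleftrightarrow> \<not> PIdl\<^bsub>aff_alg I\<^esub> g \<subseteq> deg_filt I (reg_index I - 1)"
      using ri_ideal_props[of "PIdl\<^bsub>aff_alg I\<^esub> g"] gP g(2) by blast+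
  qed
  obtain g0 where g0: "g0 \<in> socle" "g0 \<noteq> \<zero>\<^bsub>aff_alg I\<^esub>" by (rule ex_socle_nonzero)
  have bounds: "d \<in> {0..reg_index I}" if "?D d" for d using that ri(1) unfolding D by blast
  have ex: "?D (ri_ideal I (PIdl\<^bsub>aff_alg I\<^esub> g0))" unfolding D using g0 by blast
  have nonneg: "0 \<le> d" if "?D d" for d using bounds[OF that] by simp
  have least: "?D (sepdeg I s Q i)" "\<And>d. ?D d \<Longrightarrow> sepdeg I s Q i \<le> d"
    using Least_int[of ?D, OF ex nonneg] unfolding sepdeg_def by blast+
  have "sepdeg I s Q i = reg_index I \<longleftrightarrow> (\<forall>d. ?D d \<longrightarrow> d = reg_index I)"
  proof
    assume eq: "sepdeg I s Q i = reg_index I"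
    show "\<forall>d. ?D d \<longrightarrow> d = reg_index I"
    proof (intro allI impI)
      fix d assume "?D d"
      then show "d = reg_index I" using least(2)[of d] bounds[of d] eq by simp
    qed
  qed (use least(1) in blast)
  also have "\<dots> \<longleftrightarrow> (\<forall>g\<in>socle. g \<noteq> \<zero>\<^bsub>aff_alg I\<^esub> \<longrightarrow> ri_ideal I (PIdl\<^bsub>aff_alg I\<^esub> g) = reg_index I)"
    unfolding D by blast
  also have "\<dots> \<longleftrightarrow> (\<forall>g\<in>socle. g \<noteq> \<zero>\<^bsub>aff_alg I\<^esub> \<longrightarrow> \<not> PIdl\<^bsub>aff_alg I\<^esub> g \<subseteq> deg_filt I (reg_index I - 1))"
    using ri(2) by blast
  finally show ?thesis .
qed

text \<open>The definite description in \<open>socle_L\<close> is justified here: two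
  representatives of a residue class differ by an element of \<open>max_id I Q i\<close>, which
  kills the socle, and the class is nonempty.\<close>

lemma socle_L_smult:
  assumes a: "a \<in> carrier (aff_alg I)" and x: "x \<in> socle"
  shows "(max_id I Q i +>\<^bsub>aff_alg I\<^esub> a) \<odot>\<^bsub>socle_L I s Q i\<^esub> x = a \<otimes>\<^bsub>aff_alg I\<^esub> x"
proof -
  let ?m = "max_id I Q i"
  interpret m: maximalideal ?m "aff_alg I" by (rule maximalideal_max_id)
  have mult: "b \<otimes>\<^bsub>aff_alg I\<^esub> x = a \<otimes>\<^bsub>aff_alg I\<^esub> x" if b: "b \<in> ?m +>\<^bsub>aff_alg I\<^esub> a" for b
  proof -
    obtain h where h: "h \<in> ?m" "b = h \<oplus>\<^bsub>aff_alg I\<^esub> a" using b by (auto simp: a_r_coset_def')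
    have "h \<in> carrier (aff_alg I)" using h(1) max_id_subset by blast
    then show ?thesis
      using h(2) a socle_carrier[OF x] max_id_socle[OF h(1) x] by (simp add: R.A.l_distr)
  qed
  have "a \<in> ?m +>\<^bsub>aff_alg I\<^esub> a"
    using abelian_subgroup.a_rcos_self[OF R.V.submodule_abelian_subgroup[OF R.ideal_submodule[OF m.ideal_axioms]] a] .
  then have "(THE y. \<forall>b\<in>?m +>\<^bsub>aff_alg I\<^esub> a. b \<otimes>\<^bsub>aff_alg I\<^esub> x = y) = a \<otimes>\<^bsub>aff_alg I\<^esub> x"
    using mult by (intro the_equality) blast+
  then show ?thesis by (simp add: socle_L_def)
qed

lemma columns_lin_indpt_socle_iff:
  assumes e: "basis_tuple class_ring (res_field I Q i) l e"
    and f: "basis_tuple class_ring (socle_K I s Q i) m f"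
  shows "columns_lin_indpt class_ring (gr_part I (reg_index I)) l m
      (\<lambda>a b. top_form I (e a \<odot>\<^bsub>socle_L I s Q i\<^esub> f b)) \<longleftrightarrow>
    (\<forall>g\<in>socle. g \<noteq> \<zero>\<^bsub>aff_alg I\<^esub> \<longrightarrow> \<not> PIdl\<^bsub>aff_alg I\<^esub> g \<subseteq> deg_filt I (reg_index I - 1))"
  unfolding gr_part_reg_index
proof (rule R.columns_lin_indpt_iff)
  show "ideal (max_id I Q i) (aff_alg I)" using maximalideal_max_id maximalideal.axioms(1) by blast
  show "basis_tuple class_ring (quot_module (aff_alg I) (max_id I Q i)) l e"
    using e by (simp add: res_field_def)
  show f': "basis_tuple class_ring ((aff_alg I)\<lparr>carrier := socle\<rparr>) m f"
    using f by (simp add: socle_K_def)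
  fix j k a assume k: "k \<in> {1..m}" and a: "a \<in> carrier (aff_alg I)" "e j = max_id I Q i +>\<^bsub>aff_alg I\<^esub> a"
  have fk: "f k \<in> socle"
    using basis_tuple_expand(1)[OF R.submodule_vs[OF R.ideal_submodule[OF ideal_socle]] f'] k by auto
  then show "top_form I (e j \<odot>\<^bsub>socle_L I s Q i\<^esub> f k)
      = deg_filt I (reg_index I - 1) +>\<^bsub>aff_alg I\<^esub> (a \<otimes>\<^bsub>aff_alg I\<^esub> f k)"
    using a socle_carrier[OF fk] by (simp add: a(2) socle_L_smult top_form_eq)
qed (use ideal_socle submodule_deg_filt max_id_socle in auto)

end

theorem proposition3p14:
  fixes I :: "('n::finite, 'k::field) mpoly set"
    and Q :: "nat \<Rightarrow> ('n, 'k) mpoly set"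
    and s i l k m :: nat
    and e :: "nat \<Rightarrow> ('n, 'k) mpoly set set"
    and f :: "nat \<Rightarrow> ('n, 'k) mpoly set"
  assumes "ideal I poly_alg" and "I \<noteq> carrier poly_alg"
    and "vectorspace.fin_dim class_ring (aff_alg I)"
    and "primary_decomposition poly_alg I s Q"
    and "i \<in> {1..s}"
    and "l = vectorspace.dim class_ring (res_field I Q i)"
    and "k = vectorspace.dim (res_field I Q i) (socle_L I s Q i)"
    and "m = l * k"
    and "basis_tuple class_ring (res_field I Q i) l e"
    and "basis_tuple class_ring (socle_K I s Q i) m f"
  shows "sepdeg I s Q i = reg_index I \<longleftrightarrow>
    columns_lin_indpt class_ring (gr_part I (reg_index I)) l m
      (\<lambda>a b. top_form I (e a \<odot>\<^bsub>socle_L I s Q i\<^esub> f b))"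
proof -
  interpret primary_component I Q s i
    using assms(1-5) by (simp add: primary_component_def primary_component_axioms_def affine_algebra_def)
  show ?thesis
    unfolding columns_lin_indpt_socle_iff[OF assms(9,10)] by (rule sepdeg_eq_reg_index_iff)
qed

end
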